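(* Let $k\ge1$ and let $G,H$ be simple graphs with $|V(G)|=|V(H)|$. Then $G$ and $H$ are homomorphism indistinguishable over $\mathcal P_k$ (i.e. $\hom(F,G)=\hom(F,H)$ for every underlying graph $F$ of a member of $\mathcal P_k$) if and only if they are algebraically $k$-equivalent.
   Context: Bilabelled graphs: $(k,k)$-bilabelled $\boldsymbol F=(F,\boldsymbol u,\boldsymbol v)$, $\boldsymbol u,\boldsymbol v\in V(F)^k$; $\boldsymbol F_G\in\mathbb C^{V(G)^k\times V(G)^k}$ has $(\boldsymbol x,\boldsymbol y)$-entry the number of homomorphisms $h:F\to G$ with $h(u_i)=x_i,h(v_i)=y_i$. Series composition $\boldsymbol F\cdot\boldsymbol F'$ glues $v_i$ to $u'_i$ (labels $\boldsymbol u,\boldsymbol v'$); parallel composition $\boldsymbol F\odot\boldsymbol F'$ identifies $u_i$ with $u'_i$, $v_i$ with $v'_i$; multiple edges removed. For $\sigma\in\mathfrak S_{2k}$, $\boldsymbol F^\sigma$ has in-labels $(w_{\sigma(1)},\dots,w_{\sigma(k)})$, out-labels $(w_{\sigma(k+1)},\dots,w_{\sigma(2k)})$ with $\boldsymbol w=\boldsymbol u\boldsymbol v$; for matrices, $(X^\sigma)_{\boldsymbol z}=X_{\boldsymbol w}$ with $w_{\sigma(i)}=z_i$. $\mathscr C_k$ = cyclic group of rotations of $(1,\dots,k,2k,\dots,k+1)$. Bilabelled minors: via edge contraction, edge deletion, deletion of unlabelled vertices. $\boldsymbol C_k$: vertices $[2k]$, in-labels $(1,\dots,k)$, out-labels $(k+1,\dots,2k)$,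 edges $\{i,i+1\}$ ($i\in[2k]\setminus\{k,2k\}$), $\{1,k+1\},\{k,2k\}$; $\boldsymbol M_k$: same vertices/labels, edges $\{i,i+k\}$. $\mathcal Q_k^P,\mathcal Q_k^S$ = bilabelled minors of $\boldsymbol C_k,\boldsymbol M_k$; $\mathcal Q_k$ their union. $\mathcal P_k$ = smallest class containing $\mathcal Q_k$ closed under series composition, $\boldsymbol F\mapsto\boldsymbol F\odot\boldsymbol Q$ ($\boldsymbol Q\in\mathcal Q_k^P$), $\boldsymbol F\mapsto\boldsymbol F^\sigma$ ($\sigma\in\mathscr C_k$). Algebraic $k$-equivalence: $\widehat{\mathcal Q}^k_G$ is the smallest subalgebra of $\mathbb C^{V(G)^k\times V(G)^k}$ containing $I$ and the all-ones $J$, closed under conjugate transpose, under $X\mapsto\boldsymbol F_G\odot X$ ($\boldsymbol F\in\mathcal Q_k^P$, $\odot$ entrywise), under $X\mapsto X^\sigma$ ($\sigma\in\mathscr C_k$), and containing all $\boldsymbol F_G$, $\boldsymbol F\in\mathcal Q_k$. $G,H$ are algebraically $k$-equivalent if there is a vector space isomorphism $\varphi:\widehat{\mathcal Q}^k_G\to\widehat{\mathcal Q}^k_H$ with $\varphi(M^* )=\varphi(M)^*$, $\varphi(MN)=\varphi(M)\varphi(N)$, $\varphi(\boldsymbol F_G\odot M)=\boldsymbol F_H\odot\varphi(M)$ ($\boldsymbol F\in\mathcal Q_k^P$), $\varphi(I)=I$, $\varphi(J)=J$, $\varphi(\boldsymbol F_G)=\boldsymbol F_H$ ($\boldsymbol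 F\in\mathcal Q_k$), $\varphi(M^\sigma)=\varphi(M)^\sigma$ ($\sigma\in\mathscr C_k$), $\mathrm{tr}\,\varphi(M)=\mathrm{tr}\,M$, for all $M,N$. *)

theory Defs
  imports "HOL-Analysis.Analysis"
begin

record 'v graph =
  gverts :: "'v set"
  gedges :: "'v set set"

definition simple_graph :: "'v graph \<Rightarrow> bool" where
  "simple_graph G \<longleftrightarrow> finite (gverts G) \<and>
     (\<forall>e\<in>gedges G. \<exists>x y. x \<noteq> y \<and> x \<in> gverts G \<and> y \<in> gverts G \<and> e = {x, y})"

text \<open>Homomorphisms from a pattern graph F (edges are sets of size 1 or 2; a size-1 edge is a loop,
  which can arise from gluing) into G.\<close>
definition homs :: "'u graph \<Rightarrow> 'v graph \<Rightarrow> ('u \<Rightarrow> 'v) set" where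
  "homs F G = {h \<in> Pi\<^sub>E (gverts F) (\<lambda>_. gverts G). \<forall>e\<in>gedges F. h ` e \<in> gedges G}"

definition hom_count :: "'u graph \<Rightarrow> 'v graph \<Rightarrow> nat" where
  "hom_count F G = card (homs F G)"

record blg =
  bgraph :: "nat graph"
  inl :: "nat list"
  outl :: "nat list"

definition map_graph :: "('u \<Rightarrow> 'v) \<Rightarrow> 'u graph \<Rightarrow> 'v graph" where
  "map_graph f G = \<lparr>gverts = f ` gverts G, gedges = (\<lambda>e. f ` e) ` gedges G\<rparr>"

definition disj_union :: "nat graph \<Rightarrow> nat graph \<Rightarrow> nat graph" where
  "disj_union F F' = \<lparr>gverts = (\<lambda>x. 2*x) ` gverts F \<union> (\<lambda>x. 2*x+1) ` gverts F',
      gedges = (\<lambda>e. (\<lambda>x. 2*x) ` e) ` gedges F \<union> (\<lambda>e. (\<lambda>x. 2*x+1) ` e) ` gedges F'\<rparr>"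

definition glue_map :: "(nat \<times> nat) set \<Rightarrow> nat \<Rightarrow> nat" where
  "glue_map P x = Min {y. (x, y) \<in> (P \<union> P\<inverse>)\<^sup>*}"

definition series :: "blg \<Rightarrow> blg \<Rightarrow> blg" where
  "series F F' =
    (let L = (\<lambda>x::nat. 2*x); R = (\<lambda>x::nat. 2*x+1);
         P = set (zip (map L (outl F)) (map R (inl F')));
         f = glue_map P
     in \<lparr>bgraph = map_graph f (disj_union (bgraph F) (bgraph F')),
         inl = map (f \<circ> L) (inl F), outl = map (f \<circ> R) (outl F')\<rparr>)"

definition parallel :: "blg \<Rightarrow> blg \<Rightarrow> blg" where
  "parallel F F' =
    (let L = (\<lambda>x::nat. 2*x); R = (\<lambda>x::nat. 2*x+1);
         P = set (zip (map L (inl F)) (map R (inl F'))) \<union> set (zip (map L (outl F)) (map R (outl F')));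
         f = glue_map P
     in \<lparr>bgraph = map_graph f (disj_union (bgraph F) (bgraph F')),
         inl = map (f \<circ> L) (inl F), outl = map (f \<circ> L) (outl F)\<rparr>)"

definition bperm :: "nat \<Rightarrow> (nat \<Rightarrow> nat) \<Rightarrow> blg \<Rightarrow> blg" where
  "bperm k \<sigma> F =
    (let w = inl F @ outl F; w' = map (\<lambda>i. w ! \<sigma> i) [0..<2*k]
     in \<lparr>bgraph = bgraph F, inl = take k w', outl = drop k w'\<rparr>)"

text \<open>The cyclic group C_k: powers of the rotation along the cyclic order
  0,1,...,k-1,2k-1,2k-2,...,k (0-based version of (1,...,k,2k,...,k+1)).\<close>
definition rot :: "nat \<Rightarrow> nat \<Rightarrow> nat" where
  "rot k i = (if i + 1 < k then i + 1
              else if i + 1 = k then 2*k - 1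
              else if i = k then 0
              else if i < 2*k then i - 1
              else i)"

definition cyc_group :: "nat \<Rightarrow> (nat \<Rightarrow> nat) set" where
  "cyc_group k = {rot k ^^ j | j. True}"

definition C_blg :: "nat \<Rightarrow> blg" where
  "C_blg k = \<lparr>bgraph = \<lparr>gverts = {0..<2*k},
       gedges = {{i, i+1} | i. i < 2*k \<and> i \<noteq> k - 1 \<and> i \<noteq> 2*k - 1} \<union> {{0, k}, {k - 1, 2*k - 1}}\<rparr>,
     inl = [0..<k], outl = [k..<2*k]\<rparr>"

definition M_blg :: "nat \<Rightarrow> blg" where
  "M_blg k = \<lparr>bgraph = \<lparr>gverts = {0..<2*k}, gedges = {{i, i+k} | i. i < k}\<rparr>,
     inl = [0..<k], outl = [k..<2*k]\<rparr>"

definition contract_edge :: "nat \<Rightarrow> nat \<Rightarrow> blg \<Rightarrow> blg" where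
  "contract_edge a b F =
    (let f = (\<lambda>x. if x = b then a else x)
     in \<lparr>bgraph = \<lparr>gverts = gverts (bgraph F) - {b},
                    gedges = (\<lambda>e. f ` e) ` (gedges (bgraph F) - {{a, b}})\<rparr>,
         inl = map f (inl F), outl = map f (outl F)\<rparr>)"

definition delete_edge :: "nat set \<Rightarrow> blg \<Rightarrow> blg" where
  "delete_edge e F = F\<lparr>bgraph := (bgraph F)\<lparr>gedges := gedges (bgraph F) - {e}\<rparr>\<rparr>"

definition delete_vertex :: "nat \<Rightarrow> blg \<Rightarrow> blg" where
  "delete_vertex x F = F\<lparr>bgraph := \<lparr>gverts = gverts (bgraph F) - {x},
                                     gedges = {e \<in> gedges (bgraph F). x \<notin> e}\<rparr>\<rparr>"

inductive bminor :: "blg \<Rightarrow> blg \<Rightarrow> bool" for B :: blg where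
  refl: "bminor B B"
| contract: "bminor B F \<Longrightarrow> a \<noteq> b \<Longrightarrow> {a, b} \<in> gedges (bgraph F) \<Longrightarrow> bminor B (contract_edge a b F)"
| del_edge: "bminor B F \<Longrightarrow> e \<in> gedges (bgraph F) \<Longrightarrow> bminor B (delete_edge e F)"
| del_vertex: "bminor B F \<Longrightarrow> x \<in> gverts (bgraph F) \<Longrightarrow> x \<notin> set (inl F) \<Longrightarrow> x \<notin> set (outl F)
     \<Longrightarrow> bminor B (delete_vertex x F)"

definition QP :: "nat \<Rightarrow> blg set" where "QP k = {F. bminor (C_blg k) F}"
definition QS :: "nat \<Rightarrow> blg set" where "QS k = {F. bminor (M_blg k) F}"
definition Q :: "nat \<Rightarrow> blg set" where "Q k = QP k \<union> QS k"

inductive_set PP :: "nat \<Rightarrow> blg set" for k :: nat where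
  base: "F \<in> Q k \<Longrightarrow> F \<in> PP k"
| ser: "F \<in> PP k \<Longrightarrow> F' \<in> PP k \<Longrightarrow> series F F' \<in> PP k"
| par: "F \<in> PP k \<Longrightarrow> F' \<in> QP k \<Longrightarrow> parallel F F' \<in> PP k"
| perm: "F \<in> PP k \<Longrightarrow> \<sigma> \<in> cyc_group k \<Longrightarrow> bperm k \<sigma> F \<in> PP k"

definition hom_indist_PP :: "nat \<Rightarrow> 'a graph \<Rightarrow> 'b graph \<Rightarrow> bool" where
  "hom_indist_PP k G H \<longleftrightarrow> (\<forall>F\<in>PP k. hom_count (bgraph F) G = hom_count (bgraph F) H)"

type_synonym 'a mat = "'a list \<Rightarrow> 'a list \<Rightarrow> complex"

definition idx :: "nat \<Rightarrow> 'a graph \<Rightarrow> 'a list set" where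
  "idx k G = {xs. length xs = k \<and> set xs \<subseteq> gverts G}"

definition hmat :: "nat \<Rightarrow> 'a graph \<Rightarrow> blg \<Rightarrow> 'a mat" where
  "hmat k G F x y = (if x \<in> idx k G \<and> y \<in> idx k G then
      of_nat (card {h \<in> homs (bgraph F) G. map h (inl F) = x \<and> map h (outl F) = y}) else 0)"

definition idm :: "nat \<Rightarrow> 'a graph \<Rightarrow> 'a mat" where
  "idm k G x y = (if x \<in> idx k G \<and> y \<in> idx k G \<and> x = y then 1 else 0)"

definition onesm :: "nat \<Rightarrow> 'a graph \<Rightarrow> 'a mat" where
  "onesm k G x y = (if x \<in> idx k G \<and> y \<in> idx k G then 1 else 0)"

definition ctrans :: "'a mat \<Rightarrow> 'a mat" where
  "ctrans X x y = cnj (X y x)"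

definition mmult :: "nat \<Rightarrow> 'a graph \<Rightarrow> 'a mat \<Rightarrow> 'a mat \<Rightarrow> 'a mat" where
  "mmult k G X Y x z = (if x \<in> idx k G \<and> z \<in> idx k G then (\<Sum>y\<in>idx k G. X x y * Y y z) else 0)"

definition hadamard :: "'a mat \<Rightarrow> 'a mat \<Rightarrow> 'a mat" where
  "hadamard X Y x y = X x y * Y x y"

definition madd :: "'a mat \<Rightarrow> 'a mat \<Rightarrow> 'a mat" where
  "madd X Y x y = X x y + Y x y"

definition mscale :: "complex \<Rightarrow> 'a mat \<Rightarrow> 'a mat" where
  "mscale c X x y = c * X x y"

text \<open>(X^sigma)_z = X_w where w_{sigma(i)} = z_i, i.e. w_j = z_{sigma^{-1}(j)}.\<close>
definition mperm :: "nat \<Rightarrow> 'a graph \<Rightarrow> (nat \<Rightarrow> nat) \<Rightarrow> 'a mat \<Rightarrow> 'a mat" where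
  "mperm k G \<sigma> X x y = (if x \<in> idx k G \<and> y \<in> idx k G then
      (let z = x @ y; w = map (\<lambda>j. z ! inv \<sigma> j) [0..<2*k] in X (take k w) (drop k w)) else 0)"

definition mtrace :: "nat \<Rightarrow> 'a graph \<Rightarrow> 'a mat \<Rightarrow> complex" where
  "mtrace k G X = (\<Sum>x\<in>idx k G. X x x)"

inductive_set QAlg :: "nat \<Rightarrow> 'a graph \<Rightarrow> 'a mat set" for k :: nat and G :: "'a graph" where
  idm: "idm k G \<in> QAlg k G"
| ones: "onesm k G \<in> QAlg k G"
| hom: "F \<in> Q k \<Longrightarrow> hmat k G F \<in> QAlg k G"
| add: "X \<in> QAlg k G \<Longrightarrow> Y \<in> QAlg k G \<Longrightarrow> madd X Y \<in> QAlg k G"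
| scale: "X \<in> QAlg k G \<Longrightarrow> mscale c X \<in> QAlg k G"
| mult: "X \<in> QAlg k G \<Longrightarrow> Y \<in> QAlg k G \<Longrightarrow> mmult k G X Y \<in> QAlg k G"
| ctrans: "X \<in> QAlg k G \<Longrightarrow> ctrans X \<in> QAlg k G"
| had: "F \<in> QP k \<Longrightarrow> X \<in> QAlg k G \<Longrightarrow> hadamard (hmat k G F) X \<in> QAlg k G"
| perm: "\<sigma> \<in> cyc_group k \<Longrightarrow> X \<in> QAlg k G \<Longrightarrow> mperm k G \<sigma> X \<in> QAlg k G"

definition alg_k_equiv :: "nat \<Rightarrow> 'a graph \<Rightarrow> 'b graph \<Rightarrow> bool" where
  "alg_k_equiv k G H \<longleftrightarrow> (\<exists>\<phi> :: 'a mat \<Rightarrow> 'b mat.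
     bij_betw \<phi> (QAlg k G) (QAlg k H) \<and>
     (\<forall>M\<in>QAlg k G. \<forall>N\<in>QAlg k G. \<phi> (madd M N) = madd (\<phi> M) (\<phi> N)) \<and>
     (\<forall>M\<in>QAlg k G. \<forall>c. \<phi> (mscale c M) = mscale c (\<phi> M)) \<and>
     (\<forall>M\<in>QAlg k G. \<phi> (ctrans M) = ctrans (\<phi> M)) \<and>
     (\<forall>M\<in>QAlg k G. \<forall>N\<in>QAlg k G. \<phi> (mmult k G M N) = mmult k H (\<phi> M) (\<phi> N)) \<and>
     (\<forall>F\<in>QP k. \<forall>M\<in>QAlg k G. \<phi> (hadamard (hmat k G F) M) = hadamard (hmat k H F) (\<phi> M)) \<and>
     \<phi> (idm k G) = idm k H \<and>
     \<phi> (onesm k G) = onesm k H \<and>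
     (\<forall>F\<in>Q k. \<phi> (hmat k G F) = hmat k H F) \<and>
     (\<forall>\<sigma>\<in>cyc_group k. \<forall>M\<in>QAlg k G. \<phi> (mperm k G \<sigma> M) = mperm k H \<sigma> (\<phi> M)) \<and>
     (\<forall>M\<in>QAlg k G. mtrace k H (\<phi> M) = mtrace k G M))"

end

theory Submission
  imports Defs "HOL-Combinatorics.Cycles"
begin

text \<open>The operations on bilabelled graphs become matrix operations on homomorphism matrices, and the sum
  of the entries of M is the trace of M J; so a trace-preserving isomorphism preserves homomorphism counts.

  Conversely, let R be the set of pairs generated from (I, I), (J, J) and the pairs of homomorphism
  matrices by applying every algebra operation to both components. Its projections are the two
  algebras, and R is contained in the span of the pairs of homomorphism matrices of members of
  \<open>PP k\<close>; this needs that \<open>PP k\<close> is closed under transposition, since conjugating a rotation by the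
  exchange of in- and out-labels inverts it. Traces are homomorphism counts of members of \<open>PP k\<close> up to
  the factor \<open>card (gverts G) ^ (2 * k)\<close>, hence agree on the two components of each pair of R.
  As M = 0 iff M M* has trace 0, the linear relation R is the graph of a bijection.\<close>

text \<open>The trace of M is the entry sum of the entrywise product of I and M, but parallel
  composition is allowed only with minors of the cycle, while I is obtained by contracting the
  matching. On the cycle, positions i and i + k are adjacent only at the two ends i = 0 and i = k -
  1, so left and right labels are identified one coordinate at a time, through the end i = 0. After
  k rounds the matrix is the trace of M times J, whose number of entries is the factor mentioned;
  equal vertex numbers let it cancel. A relation is used rather than a map because an element of the
  algebra has many expressions in the generators: a map defined on expressions would need exactly
  the well-definedness that the trace argument supplies. The two components of a generating pair
  belong to one pattern graph, so the closure properties of \<open>PP k\<close> are proved with a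
  single graph serving G and H at once.\<close>

section \<open>Well-formed bilabelled graphs and their homomorphisms\<close>

definition wf_blg :: "nat \<Rightarrow> blg \<Rightarrow> bool" where
  "wf_blg k F \<longleftrightarrow> finite (gverts (bgraph F)) \<and> (\<forall>e\<in>gedges (bgraph F). e \<subseteq> gverts (bgraph F)) \<and>
     length (inl F) = k \<and> length (outl F) = k \<and>
     set (inl F) \<subseteq> gverts (bgraph F) \<and> set (outl F) \<subseteq> gverts (bgraph F)"

lemma wf_blgD:
  assumes "wf_blg k F"
  shows "finite (gverts (bgraph F))" "\<And>e. e \<in> gedges (bgraph F) \<Longrightarrow> e \<subseteq> gverts (bgraph F)"
    "length (inl F) = k" "length (outl F) = k"
    "set (inl F) \<subseteq> gverts (bgraph F)" "set (outl F) \<subseteq> gverts (bgraph F)"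
  using assms by (auto simp: wf_blg_def)

lemma finite_homs: "finite (gverts F) \<Longrightarrow> finite (gverts G) \<Longrightarrow> finite (homs F G)"
  unfolding homs_def by (rule finite_subset[OF _ finite_PiE[of "gverts F" "\<lambda>_. gverts G"]]) auto

lemma finite_idx: "finite (gverts G) \<Longrightarrow> finite (idx k G)"
  unfolding idx_def using finite_lists_length_eq[of "gverts G" k] by (simp add: conj_commute)

lemma map_hom_in_idx:
  assumes "h \<in> homs F G" "set xs \<subseteq> gverts F" "length xs = k"
  shows "map h xs \<in> idx k G"
  using assms by (auto simp: homs_def idx_def PiE_def Pi_def)

subsection \<open>Gluing\<close>

text \<open>\<open>Min\<close> picks a member of the class only if the class is finite; apart from x
  itself, a class lies in the field of the finite relation P.\<close>

lemma glue_map_rel: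
  assumes "finite P"
  shows "(x, glue_map P x) \<in> (P \<union> P\<inverse>)\<^sup>*"
proof -
  let ?A = "{y. (x, y) \<in> (P \<union> P\<inverse>)\<^sup>*}"
  have "?A \<subseteq> insert x (Field P)"
  proof
    fix y assume "y \<in> ?A"
    then have "(x, y) \<in> (P \<union> P\<inverse>)\<^sup>*" by simp
    then show "y \<in> insert x (Field P)" by (cases rule: rtranclE) (auto simp: Field_def)
  qed
  then have "finite ?A"
    using assms by (meson finite.insertI finite_Field finite_subset)
  then have "Min ?A \<in> ?A"
    by (intro Min_in) auto
  then show ?thesis by (simp add: glue_map_def)
qed

lemma glue_map_eq:
  assumes "(x, y) \<in> P"
  shows "glue_map P x = glue_map P y"
proof -
  have "(x, y) \<in> (P \<union> P\<inverse>)\<^sup>*" "(y, x) \<in> (P \<union> P\<inverse>)\<^sup>*" using assms by auto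
  then have "{z. (x, z) \<in> (P \<union> P\<inverse>)\<^sup>*} = {z. (y, z) \<in> (P \<union> P\<inverse>)\<^sup>*}"
    by (auto intro: rtrancl_trans)
  then show ?thesis by (simp add: glue_map_def)
qed

text \<open>With \<open>glue_map_eq\<close> this is the universal property of the quotient by P: a
  function that agrees on glued pairs is constant along every path of such pairs, hence factors
  through \<open>glue_map P\<close>.\<close>

lemma glue_map_const:
  assumes "finite P" "\<And>a b. (a, b) \<in> P \<Longrightarrow> h a = h b"
  shows "h (glue_map P x) = h x"
proof -
  have "h x = h y" if "(x, y) \<in> (P \<union> P\<inverse>)\<^sup>*" for y
    using that by induction (use assms(2) in force)+
  then show ?thesis using glue_map_rel[OF assms(1), of x] by simp
qed

lemma restrict_hom:
  assumes "\<forall>e\<in>gedges F. e \<subseteq> gverts F" "\<And>v. v \<in> gverts F \<Longrightarrow> h v \<in> gverts G"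
    "\<And>e. e \<in> gedges F \<Longrightarrow> h ` e \<in> gedges G"
  shows "restrict h (gverts F) \<in> homs F G"
proof -
  have "restrict h (gverts F) ` e = h ` e" if "e \<in> gedges F" for e
    using assms(1) that by (intro image_cong) auto
  then show ?thesis using assms by (auto simp: homs_def)
qed

lemma hom_edge: "h \<in> homs F G \<Longrightarrow> e \<in> gedges F \<Longrightarrow> h ` e \<in> gedges G"
  and hom_vert: "h \<in> homs F G \<Longrightarrow> v \<in> gverts F \<Longrightarrow> h v \<in> gverts G"
  and hom_undefined: "h \<in> homs F G \<Longrightarrow> v \<notin> gverts F \<Longrightarrow> h v = undefined"
  by (auto simp: homs_def)

text \<open>The glued graph is the pushout of F and F' along P, so a homomorphism out of it amounts
  to two homomorphisms that agree on P. An arbitrary P serves both compositions, which differ only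
  in the labels that they glue.\<close>

lemma glue_homs:
  fixes F F' :: "nat graph" and G :: "'a graph"
  assumes fin: "finite P" and P: "P \<subseteq> gverts F \<times> gverts F'"
    and EF: "\<forall>e\<in>gedges F. e \<subseteq> gverts F" and EF': "\<forall>e\<in>gedges F'. e \<subseteq> gverts F'"
    and f: "f = glue_map ((\<lambda>(a, b). (2 * a, 2 * b + 1)) ` P)"
  shows "bij_betw
    (\<lambda>g. (restrict (\<lambda>v. g (f (2 * v))) (gverts F), restrict (\<lambda>v. g (f (2 * v + 1))) (gverts F')))
    (homs (map_graph f (disj_union F F')) G)
    {(h, h'). h \<in> homs F G \<and> h' \<in> homs F' G \<and> (\<forall>(a, b)\<in>P. h a = h' b)}"
    (is "bij_betw ?j ?A ?B")
proof -
  let ?U = "map_graph f (disj_union F F')"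
  \<comment> \<open>A pair of homomorphisms merged into one function on the disjoint union, where
    even codes come from F and odd codes from F'.\<close>
  define m where "m = (\<lambda>(h :: nat \<Rightarrow> 'a, h' :: nat \<Rightarrow> 'a) n. if even n then h (n div 2) else h' (n div 2))"
  have finP: "finite ((\<lambda>(a, b). (2 * a, 2 * b + 1 :: nat)) ` P)" using fin by simp
  have VU: "gverts ?U = (\<lambda>v. f (2 * v)) ` gverts F \<union> (\<lambda>v. f (2 * v + 1)) ` gverts F'"
    by (auto simp: map_graph_def disj_union_def)
  have EU: "gedges ?U = (\<lambda>e. (\<lambda>v. f (2 * v)) ` e) ` gedges F \<union> (\<lambda>e. (\<lambda>v. f (2 * v + 1)) ` e) ` gedges F'"
    by (simp add: map_graph_def disj_union_def image_Un image_image)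
  have EUV: "\<forall>e\<in>gedges ?U. e \<subseteq> gverts ?U"
    unfolding VU EU using EF EF' by blast
  \<comment> \<open>Agreement on P makes the merged function constant on glued codes, so passing to
    the representative changes nothing.\<close>
  have m_f: "m p (f n) = m p n" if "\<forall>(a, b)\<in>P. fst p a = snd p b" for p n
    unfolding f by (rule glue_map_const[OF finP]) (use that in \<open>auto simp: m_def split: prod.splits\<close>)
  have m2: "m p (f (2 * v)) = fst p v" "m p (f (2 * v + 1)) = snd p v"
    if "\<forall>(a, b)\<in>P. fst p a = snd p b" for p v
    using m_f[OF that] by (auto simp: m_def split: prod.splits)
  show ?thesis
  proof (rule bij_betw_byWitness[where f' = "\<lambda>p. restrict (m p) (gverts ?U)"])
    show "\<forall>g\<in>?A. restrict (m (?j g)) (gverts ?U) = g"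
    proof
      fix g assume g: "g \<in> ?A"
      let ?p = "?j g"
      have c: "\<forall>(a, b)\<in>P. fst ?p a = snd ?p b"
      proof clarify
        fix a b assume ab: "(a, b) \<in> P"
        then have "f (2 * a) = f (2 * b + 1)" unfolding f by (intro glue_map_eq) force
        then show "fst ?p a = snd ?p b" using ab P by auto
      qed
      show "restrict (m ?p) (gverts ?U) = g"
      proof
        fix n show "restrict (m ?p) (gverts ?U) n = g n"
        proof (cases "n \<in> gverts ?U")
          case True
          then have "m ?p n = g n" unfolding VU
            using m2[OF c] by auto
          then show ?thesis using True by simp
        next
          case False then show ?thesis using hom_undefined[OF g] by simp
        qed
      qed
    qed
    show "\<forall>p\<in>?B. ?j (restrict (m p) (gverts ?U)) = p"
    proof
      fix p assume "p \<in> ?B"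
      then obtain h h' where p: "p = (h, h')" and h: "h \<in> homs F G" "h' \<in> homs F' G"
        and c: "\<forall>(a, b)\<in>P. fst (h, h') a = snd (h, h') b" by auto
      have "restrict (\<lambda>v. restrict (m (h, h')) (gverts ?U) (f (2 * v))) (gverts F) = h"
      proof
        fix v show "restrict (\<lambda>v. restrict (m (h, h')) (gverts ?U) (f (2 * v))) (gverts F) v = h v"
          using m2(1)[OF c, of v] hom_undefined[OF h(1), of v] by (auto simp: VU)
      qed
      moreover have "restrict (\<lambda>v. restrict (m (h, h')) (gverts ?U) (f (2 * v + 1))) (gverts F') = h'"
      proof
        fix v show "restrict (\<lambda>v. restrict (m (h, h')) (gverts ?U) (f (2 * v + 1))) (gverts F') v = h' v"
          using m2(2)[OF c, of v] hom_undefined[OF h(2), of v] by (auto simp: VU)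
      qed
      ultimately show "?j (restrict (m p) (gverts ?U)) = p" using p by simp
    qed
    show "?j ` ?A \<subseteq> ?B"
    proof (rule image_subsetI)
      fix g assume g: "g \<in> ?A"
      have E: "(\<lambda>v. g (f (2 * v))) ` e \<in> gedges G" if "e \<in> gedges F" for e
        using hom_edge[OF g, of "(\<lambda>v. f (2 * v)) ` e"] that unfolding EU by (simp add: image_image)
      have E': "(\<lambda>v. g (f (2 * v + 1))) ` e \<in> gedges G" if "e \<in> gedges F'" for e
        using hom_edge[OF g, of "(\<lambda>v. f (2 * v + 1)) ` e"] that unfolding EU by (simp add: image_image)
      have "restrict (\<lambda>v. g (f (2 * v))) (gverts F) \<in> homs F G"
        using hom_vert[OF g] E by (intro restrict_hom[OF EF]) (auto simp: VU)
      moreover have "restrict (\<lambda>v. g (f (2 * v + 1))) (gverts F') \<in> homs F' G"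
        using hom_vert[OF g] E' by (intro restrict_hom[OF EF']) (auto simp: VU)
      moreover have "\<forall>(a, b)\<in>P. restrict (\<lambda>v. g (f (2 * v))) (gverts F) a = restrict (\<lambda>v. g (f (2 * v + 1))) (gverts F') b"
      proof clarify
        fix a b assume ab: "(a, b) \<in> P"
        then have "f (2 * a) = f (2 * b + 1)" unfolding f by (intro glue_map_eq) force
        then show "restrict (\<lambda>v. g (f (2 * v))) (gverts F) a = restrict (\<lambda>v. g (f (2 * v + 1))) (gverts F') b"
          using ab P by auto
      qed
      ultimately show "?j g \<in> ?B" by blast
    qed
    show "(\<lambda>p. restrict (m p) (gverts ?U)) ` ?B \<subseteq> ?A"
    proof (rule image_subsetI)
      fix p assume "p \<in> ?B"
      then obtain h h' where p: "p = (h, h')" and h: "h \<in> homs F G" "h' \<in> homs F' G"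
        and c: "\<forall>(a, b)\<in>P. fst (h, h') a = snd (h, h') b" by auto
      show "restrict (m p) (gverts ?U) \<in> ?A"
        unfolding p
      proof (rule restrict_hom[OF EUV])
        fix v assume "v \<in> gverts ?U"
        then show "m (h, h') v \<in> gverts G"
          unfolding VU using m2[OF c] h by (auto intro: hom_vert)
      next
        fix e assume "e \<in> gedges ?U"
        then show "m (h, h') ` e \<in> gedges G"
          unfolding EU using m2[OF c] h by (auto simp: image_image dest: hom_edge)
      qed
    qed
  qed
qed

lemma card_bij_Collect:
  assumes "bij_betw j A B"
  shows "card {a \<in> A. R (j a)} = card {b \<in> B. R b}"
proof -
  have "bij_betw j {a \<in> A. R (j a)} {b \<in> B. R b}"
    using assms by (auto simp: bij_betw_def inj_on_def)
  then show ?thesis by (rule bij_betw_same_card)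
qed

lemma zip_eq_iff_map_eq:
  assumes "length xs = length ys"
  shows "(\<forall>(a, b)\<in>set (zip xs ys). h a = h' b) \<longleftrightarrow> map h xs = map h' ys"
  using assms by (induction xs ys rule: list_induct2) auto

lemma zip_double:
  "set (zip (map (\<lambda>x. 2 * x) xs) (map (\<lambda>x. 2 * x + 1) ys)) = (\<lambda>(a, b). (2 * a, 2 * b + 1 :: nat)) ` set (zip xs ys)"
  by (simp add: zip_map_map)

section \<open>Homomorphism matrices of series and parallel compositions\<close>

text \<open>Gluing forces the images of the out-labels of F and of the in-labels of F' to be one
  common tuple w. Sorting the pairs of homomorphisms by w gives the sum over the middle index of a
  matrix product.\<close>

lemma hmat_series:
  fixes G :: "'a graph"
  assumes F: "wf_blg k F" and F': "wf_blg k F'" and G: "finite (gverts G)"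
  shows "hmat k G (series F F') = mmult k G (hmat k G F) (hmat k G F')"
proof (intro ext)
  fix x y :: "'a list"
  define P where "P = set (zip (outl F) (inl F'))"
  define f where "f = glue_map ((\<lambda>(a, b). (2 * a, 2 * b + 1)) ` P)"
  let ?A = "homs (bgraph F) G" and ?B = "homs (bgraph F') G"
  let ?S = "\<lambda>w. {h \<in> ?A. map h (inl F) = x \<and> map h (outl F) = w}"
  let ?T = "\<lambda>w. {h \<in> ?B. map h (inl F') = w \<and> map h (outl F') = y}"
  have PV: "P \<subseteq> gverts (bgraph F) \<times> gverts (bgraph F')"
    using wf_blgD[OF F] wf_blgD[OF F'] unfolding P_def by (auto dest: set_zip_leftD set_zip_rightD)
  have s: "series F F' = \<lparr>bgraph = map_graph f (disj_union (bgraph F) (bgraph F')),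
      inl = map (\<lambda>v. f (2 * v)) (inl F), outl = map (\<lambda>v. f (2 * v + 1)) (outl F')\<rparr>"
    unfolding series_def Let_def zip_double f_def P_def by (simp add: comp_def)
  let ?j = "\<lambda>g. (restrict (\<lambda>v. g (f (2 * v))) (gverts (bgraph F)), restrict (\<lambda>v. g (f (2 * v + 1))) (gverts (bgraph F')))"
  have b: "bij_betw ?j (homs (map_graph f (disj_union (bgraph F) (bgraph F'))) G)
     {(h, h'). h \<in> ?A \<and> h' \<in> ?B \<and> (\<forall>(a, b)\<in>P. h a = h' b)}"
    using F F' PV by (intro glue_homs) (auto simp: f_def P_def wf_blg_def)
  have "map g (inl (series F F')) = map (fst (?j g)) (inl F)"
      "map g (outl (series F F')) = map (snd (?j g)) (outl F')" for g :: "nat \<Rightarrow> 'a"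
    using wf_blgD(5,6)[OF F] wf_blgD(5,6)[OF F'] by (auto simp: s)
  then have "card {g \<in> homs (bgraph (series F F')) G. map g (inl (series F F')) = x \<and> map g (outl (series F F')) = y}
     = card {g \<in> homs (map_graph f (disj_union (bgraph F) (bgraph F'))) G.
          map (fst (?j g)) (inl F) = x \<and> map (snd (?j g)) (outl F') = y}"
    by (simp only:) (simp add: s)
  also have "\<dots> = card {p \<in> {(h, h'). h \<in> ?A \<and> h' \<in> ?B \<and> (\<forall>(a, b)\<in>P. h a = h' b)}. map (fst p) (inl F) = x \<and> map (snd p) (outl F') = y}"
    by (rule card_bij_Collect[OF b])
  also have "{p \<in> {(h, h'). h \<in> ?A \<and> h' \<in> ?B \<and> (\<forall>(a, b)\<in>P. h a = h' b)}. map (fst p) (inl F) = x \<and> map (snd p) (outl F') = y}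
      = (\<Union>w\<in>idx k G. ?S w \<times> ?T w)"
  proof -
    have "(\<forall>(a, b)\<in>P. h a = h' b) \<longleftrightarrow> map h (outl F) = map h' (inl F')" for h h' :: "nat \<Rightarrow> 'a"
      unfolding P_def using wf_blgD[OF F] wf_blgD[OF F'] by (intro zip_eq_iff_map_eq) simp
    moreover have "map h (outl F) \<in> idx k G" if "h \<in> ?A" for h
      using wf_blgD[OF F] by (intro map_hom_in_idx[OF that]) auto
    ultimately show ?thesis by (auto simp del: map_eq_conv) metis
  qed
  also have "card \<dots> = (\<Sum>w\<in>idx k G. card (?S w \<times> ?T w))"
    using finite_idx[OF G] finite_homs[OF wf_blgD(1)[OF F] G] finite_homs[OF wf_blgD(1)[OF F'] G]
    by (intro card_UN_disjoint) auto
  also have "\<dots> = (\<Sum>w\<in>idx k G. card (?S w) * card (?T w))"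
    by (simp add: card_cartesian_product)
  finally show "hmat k G (series F F') x y = mmult k G (hmat k G F) (hmat k G F') x y"
    unfolding mmult_def hmat_def by simp
qed

text \<open>All labels are glued, so prescribing the images of the labels of F prescribes them for
  F' too, and nothing else links the two homomorphisms: the counts multiply.\<close>

lemma hmat_parallel:
  fixes G :: "'a graph"
  assumes F: "wf_blg k F" and F': "wf_blg k F'"
  shows "hmat k G (parallel F F') = hadamard (hmat k G F) (hmat k G F')"
proof (intro ext)
  fix x y :: "'a list"
  define P where "P = set (zip (inl F) (inl F')) \<union> set (zip (outl F) (outl F'))"
  define f where "f = glue_map ((\<lambda>(a, b). (2 * a, 2 * b + 1)) ` P)"
  let ?A = "homs (bgraph F) G" and ?B = "homs (bgraph F') G"
  let ?S = "{h \<in> ?A. map h (inl F) = x \<and> map h (outl F) = y}"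
  let ?T = "{h \<in> ?B. map h (inl F') = x \<and> map h (outl F') = y}"
  have PV: "P \<subseteq> gverts (bgraph F) \<times> gverts (bgraph F')"
    using wf_blgD[OF F] wf_blgD[OF F'] unfolding P_def by (auto dest: set_zip_leftD set_zip_rightD)
  have s: "parallel F F' = \<lparr>bgraph = map_graph f (disj_union (bgraph F) (bgraph F')),
      inl = map (\<lambda>v. f (2 * v)) (inl F), outl = map (\<lambda>v. f (2 * v)) (outl F)\<rparr>"
    unfolding parallel_def Let_def zip_double f_def P_def by (simp add: comp_def image_Un)
  let ?j = "\<lambda>g. (restrict (\<lambda>v. g (f (2 * v))) (gverts (bgraph F)), restrict (\<lambda>v. g (f (2 * v + 1))) (gverts (bgraph F')))"
  have b: "bij_betw ?j (homs (map_graph f (disj_union (bgraph F) (bgraph F'))) G)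
     {(h, h'). h \<in> ?A \<and> h' \<in> ?B \<and> (\<forall>(a, b)\<in>P. h a = h' b)}"
    using F F' PV by (intro glue_homs) (auto simp: f_def P_def wf_blg_def)
  have "map g (inl (parallel F F')) = map (fst (?j g)) (inl F)"
      "map g (outl (parallel F F')) = map (fst (?j g)) (outl F)" for g :: "nat \<Rightarrow> 'a"
    using wf_blgD(5,6)[OF F] wf_blgD(5,6)[OF F'] by (auto simp: s)
  then have "card {g \<in> homs (bgraph (parallel F F')) G. map g (inl (parallel F F')) = x \<and> map g (outl (parallel F F')) = y}
     = card {g \<in> homs (map_graph f (disj_union (bgraph F) (bgraph F'))) G.
          map (fst (?j g)) (inl F) = x \<and> map (fst (?j g)) (outl F) = y}"
    by (simp only:) (simp add: s)
  also have "\<dots> = card {p \<in> {(h, h'). h \<in> ?A \<and> h' \<in> ?B \<and> (\<forall>(a, b)\<in>P. h a = h' b)}. map (fst p) (inl F) = x \<and> map (fst p) (outl F) = y}"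
    by (rule card_bij_Collect[OF b])
  also have "{p \<in> {(h, h'). h \<in> ?A \<and> h' \<in> ?B \<and> (\<forall>(a, b)\<in>P. h a = h' b)}. map (fst p) (inl F) = x \<and> map (fst p) (outl F) = y}
      = ?S \<times> ?T"
  proof -
    have "(\<forall>(a, b)\<in>P. h a = h' b) \<longleftrightarrow> map h (inl F) = map h' (inl F') \<and> map h (outl F) = map h' (outl F')"
      for h h' :: "nat \<Rightarrow> 'a"
      unfolding P_def ball_Un using wf_blgD[OF F] wf_blgD[OF F'] by (intro arg_cong2[where f = "(\<and>)"] zip_eq_iff_map_eq) simp_all
    then show ?thesis by auto
  qed
  finally show "hmat k G (parallel F F') x y = hadamard (hmat k G F) (hmat k G F') x y"
    unfolding hadamard_def hmat_def by (simp add: card_cartesian_product)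
qed

section \<open>Well-formedness of compositions and minors\<close>

text \<open>Gluing may turn an edge into a loop, which is why \<open>wf_blg\<close> only asks that
  edges lie inside the vertex set.\<close>

lemma wf_glue:
  assumes "wf_blg k F" "wf_blg k F'"
    "set xs \<subseteq> gverts (disj_union (bgraph F) (bgraph F'))" "set ys \<subseteq> gverts (disj_union (bgraph F) (bgraph F'))"
    "length xs = k" "length ys = k"
  shows "wf_blg k \<lparr>bgraph = map_graph f (disj_union (bgraph F) (bgraph F')), inl = map f xs, outl = map f ys\<rparr>"
proof -
  let ?U = "disj_union (bgraph F) (bgraph F')"
  have fin: "finite (gverts ?U)"
    using wf_blgD(1)[OF assms(1)] wf_blgD(1)[OF assms(2)] by (simp add: disj_union_def)
  have "e \<subseteq> gverts ?U" if "e \<in> gedges ?U" for e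
    using that wf_blgD(2)[OF assms(1)] wf_blgD(2)[OF assms(2)] by (fastforce simp: disj_union_def)
  then have "\<forall>e\<in>gedges (map_graph f ?U). e \<subseteq> gverts (map_graph f ?U)"
    by (simp add: map_graph_def image_mono)
  moreover have "finite (gverts (map_graph f ?U))" using fin by (simp add: map_graph_def)
  moreover have "set (map f xs) \<subseteq> gverts (map_graph f ?U)" "set (map f ys) \<subseteq> gverts (map_graph f ?U)"
    using assms(3,4) by (auto simp: map_graph_def)
  ultimately show ?thesis using assms(5,6) by (simp add: wf_blg_def)
qed

lemma wf_series:
  assumes "wf_blg k F" "wf_blg k F'"
  shows "wf_blg k (series F F')"
  using wf_blgD[OF assms(1)] wf_blgD[OF assms(2)]
  unfolding series_def Let_def map_map[symmetric]
  by (intro wf_glue[OF assms]) (auto simp: disj_union_def)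

lemma wf_parallel:
  assumes "wf_blg k F" "wf_blg k F'"
  shows "wf_blg k (parallel F F')"
  using wf_blgD[OF assms(1)] wf_blgD[OF assms(2)]
  unfolding parallel_def Let_def map_map[symmetric]
  by (intro wf_glue[OF assms]) (auto simp: disj_union_def)

lemma wf_bminor:
  assumes "bminor B F" "wf_blg k B"
  shows "wf_blg k F"
  using assms(1)
proof induction
  case refl
  then show ?case using assms(2) .
next
  case (contract F a b)
  note w = wf_blgD[OF contract.IH]
  let ?c = "\<lambda>x. if x = b then a else x"
  have "a \<in> gverts (bgraph F)" using w(2)[OF contract.hyps(3)] by simp
  then have c: "?c ` A \<subseteq> gverts (bgraph F) - {b}" if "A \<subseteq> gverts (bgraph F)" for A
    using that contract.hyps(2) by auto
  have "e \<subseteq> gverts (bgraph F) - {b}" if "e \<in> (\<lambda>e. ?c ` e) ` (gedges (bgraph F) - {{a, b}})" for e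
  proof -
    from that obtain e' where e': "e = ?c ` e'" "e' \<in> gedges (bgraph F)" by blast
    show ?thesis unfolding e'(1) by (rule c[OF w(2)[OF e'(2)]])
  qed
  then show ?case
    unfolding wf_blg_def contract_edge_def Let_def using w(1,3,4) c[OF w(5)] c[OF w(6)] by simp
next
  case (del_edge F e)
  from wf_blgD[OF del_edge.IH] show ?case by (simp add: wf_blg_def delete_edge_def)
next
  case (del_vertex F x)
  from wf_blgD[OF del_vertex.IH] del_vertex.hyps show ?case
    unfolding wf_blg_def delete_vertex_def by (simp add: subset_Diff_insert)
qed

lemma wf_C_blg: "k \<ge> 1 \<Longrightarrow> wf_blg k (C_blg k)"
  by (auto simp: wf_blg_def C_blg_def)

lemma wf_M_blg: "wf_blg k (M_blg k)"
  by (auto simp: wf_blg_def M_blg_def)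

lemma wf_Q: "k \<ge> 1 \<Longrightarrow> F \<in> Q k \<Longrightarrow> wf_blg k F"
  unfolding Q_def QP_def QS_def using wf_bminor wf_C_blg wf_M_blg by blast

lemma QP_subset_Q: "F \<in> QP k \<Longrightarrow> F \<in> Q k" and QS_subset_Q: "F \<in> QS k \<Longrightarrow> F \<in> Q k"
  by (auto simp: Q_def)

subsection \<open>Rotations\<close>

lemma rot_permutes:
  assumes "k \<ge> 1"
  shows "rot k permutes {0..<2*k}"
proof (rule bij_imp_permutes)
  have "inj_on (rot k) {0..<2*k}"
    using assms by (auto simp: inj_on_def rot_def split: if_splits)
  moreover have "rot k ` {0..<2*k} \<subseteq> {0..<2*k}"
    using assms by (auto simp: rot_def)
  ultimately show "bij_betw (rot k) {0..<2*k} {0..<2*k}"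
    by (simp add: bij_betw_def endo_inj_surj)
qed (use assms in \<open>auto simp: rot_def\<close>)

lemma permutes_funpow: "p permutes S \<Longrightarrow> (p ^^ n) permutes S"
  by (induction n) (auto simp: permutes_id[unfolded id_def] id_def intro: permutes_compose)

lemma cyc_group_permutes: "k \<ge> 1 \<Longrightarrow> \<sigma> \<in> cyc_group k \<Longrightarrow> \<sigma> permutes {0..<2*k}"
  unfolding cyc_group_def using permutes_funpow rot_permutes by blast

lemma idx_split:
  assumes "length w = 2 * k" "set w \<subseteq> gverts G"
  shows "take k w \<in> idx k G" "drop k w \<in> idx k G"
  using assms by (auto simp: idx_def dest: in_set_takeD in_set_dropD)

lemma permute_in_idx:
  assumes "\<sigma> permutes {0..<2*k}" "x \<in> idx k G" "y \<in> idx k G"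
  shows "take k (map (\<lambda>j. (x @ y) ! inv \<sigma> j) [0..<2*k]) \<in> idx k G"
    "drop k (map (\<lambda>j. (x @ y) ! inv \<sigma> j) [0..<2*k]) \<in> idx k G"
proof -
  have "(x @ y) ! inv \<sigma> j \<in> set (x @ y)" if "j < 2 * k" for j
    using permutes_in_image[OF permutes_inv[OF assms(1)], of j] that assms(2,3)
    by (intro nth_mem) (auto simp: idx_def)
  then have "set (map (\<lambda>j. (x @ y) ! inv \<sigma> j) [0..<2*k]) \<subseteq> gverts G"
    using assms(2,3) by (fastforce simp: idx_def)
  then show "take k (map (\<lambda>j. (x @ y) ! inv \<sigma> j) [0..<2*k]) \<in> idx k G"
    "drop k (map (\<lambda>j. (x @ y) ! inv \<sigma> j) [0..<2*k]) \<in> idx k G"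
    by (intro idx_split; simp)+
qed

lemma wf_bperm:
  assumes "wf_blg k F" "\<sigma> permutes {0..<2*k}"
  shows "wf_blg k (bperm k \<sigma> F)"
proof -
  let ?w = "map (\<lambda>i. (inl F @ outl F) ! \<sigma> i) [0..<2*k]"
  have "(inl F @ outl F) ! \<sigma> j \<in> set (inl F @ outl F)" if "j < 2 * k" for j
    using permutes_in_image[OF assms(2), of j] that wf_blgD(3,4)[OF assms(1)]
    by (intro nth_mem) auto
  then have "set ?w \<subseteq> gverts (bgraph F)"
    using wf_blgD(5,6)[OF assms(1)] by fastforce
  then have "set (take k ?w) \<subseteq> gverts (bgraph F)" "set (drop k ?w) \<subseteq> gverts (bgraph F)"
    by (meson order_trans set_take_subset set_drop_subset)+
  then show ?thesis
    using assms(1) unfolding wf_blg_def bperm_def Let_def by simp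
qed

text \<open>\<open>bperm\<close> puts label \<open>\<sigma> i\<close> at position i, so prescribing
  the images of the permuted labels reads h (w ! \<sigma> i) = (x @ y) ! i. Substituting j =
  \<sigma> i expresses this for the original labels and produces the \<open>inv\<close> in
  \<open>mperm\<close>.\<close>

lemma hmat_bperm:
  fixes G :: "'a graph"
  assumes F: "wf_blg k F" and s: "\<sigma> permutes {0..<2*k}"
  shows "hmat k G (bperm k \<sigma> F) = mperm k G \<sigma> (hmat k G F)"
proof (intro ext)
  fix x y :: "'a list"
  show "hmat k G (bperm k \<sigma> F) x y = mperm k G \<sigma> (hmat k G F) x y"
  proof (cases "x \<in> idx k G \<and> y \<in> idx k G")
    case True
    then have l: "length x = k" "length y = k" by (auto simp: idx_def)
    define w where "w = inl F @ outl F"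
    define w' where "w' = map (\<lambda>i. w ! \<sigma> i) [0..<2*k]"
    define z where "z = map (\<lambda>j. (x @ y) ! inv \<sigma> j) [0..<2*k]"
    have lw: "length w = 2 * k" using wf_blgD(3,4)[OF F] by (simp add: w_def)
    have mem: "\<sigma> i < 2 * k \<longleftrightarrow> i < 2 * k" "inv \<sigma> i < 2 * k \<longleftrightarrow> i < 2 * k" for i
      using permutes_in_image[OF s, of i] permutes_in_image[OF permutes_inv[OF s], of i] by auto
    have "map h (take k w') = x \<and> map h (drop k w') = y \<longleftrightarrow> map h (inl F) = take k z \<and> map h (outl F) = drop k z"
      for h :: "nat \<Rightarrow> 'a"
    proof -
      have "map h (take k w') = x \<and> map h (drop k w') = y \<longleftrightarrow> map h w' = x @ y"
      proof -
        have "map h w' = map h (take k w') @ map h (drop k w')"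
          by (metis append_take_drop_id map_append)
        moreover have "length (map h (take k w')) = length x" using l by (simp add: w'_def)
        ultimately show ?thesis by simp
      qed
      also have "\<dots> \<longleftrightarrow> (\<forall>i<2*k. h (w ! \<sigma> i) = (x @ y) ! i)"
        using l by (simp add: list_eq_iff_nth_eq w'_def)
      also have "\<dots> \<longleftrightarrow> (\<forall>j<2*k. h (w ! j) = (x @ y) ! inv \<sigma> j)"
        using mem permutes_inverses[OF s] by metis
      also have "\<dots> \<longleftrightarrow> map h w = z"
        using lw by (simp add: list_eq_iff_nth_eq z_def)
      also have "\<dots> \<longleftrightarrow> map h (inl F) = take k z \<and> map h (outl F) = drop k z"
        using wf_blgD(3,4)[OF F] by (simp add: w_def append_eq_conv_conj)
      finally show ?thesis .
    qed
    then show ?thesis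
      using True permute_in_idx[OF s, of x G y] unfolding hmat_def mperm_def Let_def bperm_def
      by (simp add: w_def w'_def z_def)
  qed (auto simp: hmat_def mperm_def)
qed

lemma wf_PP:
  assumes "k \<ge> 1" "F \<in> PP k"
  shows "wf_blg k F"
  using assms(2)
proof induction
  case (par F F')
  then show ?case using wf_Q[OF assms(1) QP_subset_Q] by (blast intro: wf_parallel)
qed (use assms(1) in \<open>blast intro: wf_Q wf_series wf_bperm cyc_group_permutes\<close>)+

subsection \<open>Transposition\<close>

text \<open>On the cyclic order 0, ..., k - 1, 2 * k - 1, ..., k that \<open>rot\<close> follows,
  this is a reflection.\<close>

definition swap_half :: "nat \<Rightarrow> nat \<Rightarrow> nat" where
  "swap_half k i = (if i < k then i + k else if i < 2 * k then i - k else i)"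

lemma swap_half_swap_half [simp]: "swap_half k (swap_half k i) = i"
  by (auto simp: swap_half_def)

lemma inj_swap_half: "inj (swap_half k)"
  by (metis injI swap_half_swap_half)

lemma swap_half_less [simp]: "swap_half k i < 2 * k \<longleftrightarrow> i < 2 * k"
  by (auto simp: swap_half_def)

lemma nth_append_swap_half:
  assumes "length x = k" "length y = k" "i < 2 * k"
  shows "(x @ y) ! swap_half k i = (y @ x) ! i"
  using assms by (auto simp: swap_half_def nth_append)

text \<open>A reflection after a rotation of a cycle is again a reflection, hence an involution. The
  cases separate moving along the in-labels, the two corners, moving back along the out-labels, and
  positions off the cycle.\<close>

lemma rot_swap_half:
  assumes "k \<ge> 1"
  shows "swap_half k (rot k (swap_half k (rot k i))) = i"
proof -
  consider "i + 1 < k" | "i + 1 = k" | "i = k" | "k < i" "i < 2 * k" | "2 * k \<le> i" by linarith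
  then show ?thesis
  proof cases
    case 1
    then have "rot k i = i + 1" "swap_half k (i + 1) = i + 1 + k" "rot k (i + 1 + k) = i + k" "swap_half k (i + k) = i"
      by (simp_all add: rot_def swap_half_def)
    then show ?thesis by simp
  next
    case 2
    then have "rot k i = 2 * k - 1" "swap_half k (2 * k - 1) = i" "rot k i = 2 * k - 1"
      by (auto simp: rot_def swap_half_def)
    then show ?thesis using 2 by (simp add: swap_half_def)
  next
    case 3
    then have "rot k i = 0" "swap_half k 0 = k" "rot k k = 0"
      using assms by (simp_all add: rot_def swap_half_def)
    then show ?thesis using 3 by simp
  next
    case 4
    then have "rot k i = i - 1" "swap_half k (i - 1) = i - 1 - k" "rot k (i - 1 - k) = i - k" "swap_half k (i - k) = i"
      by (auto simp: rot_def swap_half_def)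
    then show ?thesis by simp
  next
    case 5
    then show ?thesis using assms by (simp add: rot_def swap_half_def)
  qed
qed

text \<open>By \<open>rot_swap_half\<close> the reflection conjugates the rotation into its inverse.
  As \<open>cyc_group\<close> consists of nonnegative powers, the inverse has to be written as such
  a power.\<close>

lemma swap_half_conj_cyc_group:
  assumes k: "k \<ge> 1" and s: "\<sigma> \<in> cyc_group k"
  shows "swap_half k \<circ> \<sigma> \<circ> swap_half k \<in> cyc_group k"
proof -
  let ?t = "swap_half k" and ?r = "rot k"
  have bij: "bij ?r" using permutes_bij[OF rot_permutes[OF k]] .
  \<comment> \<open>A permutation of a finite set has finite order, so the power n - 1 of the
    rotation is its inverse.\<close>
  obtain n where n: "?r ^^ n = id" "n > 0"
    using permutation_is_nilpotent[of ?r] rot_permutes[OF k] permutation_permutes by blast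
  have "?t (?r (?t (?r i))) = (?r ^^ (n - 1)) (?r i)" for i
  proof -
    have "(?r ^^ (n - 1)) (?r i) = (?r ^^ Suc (n - 1)) i" by (simp add: funpow_swap1)
    also have "\<dots> = i" using n by simp
    finally show ?thesis by (simp only: rot_swap_half[OF k])
  qed
  then have c: "?t (?r (?t i)) = (?r ^^ (n - 1)) i" for i
    using bij by (metis bij_pointE)
  have c': "?t ((?r ^^ m) (?t i)) = ((?r ^^ (n - 1)) ^^ m) i" for m i
  proof (induction m)
    case (Suc m)
    have "?t ((?r ^^ Suc m) (?t i)) = ?t (?r (?t (?t ((?r ^^ m) (?t i)))))" by simp
    also have "\<dots> = (?r ^^ (n - 1)) (((?r ^^ (n - 1)) ^^ m) i)" unfolding c Suc ..
    finally show ?case by simp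
  qed simp
  obtain m where "\<sigma> = ?r ^^ m" using s by (auto simp: cyc_group_def)
  then have "?t \<circ> \<sigma> \<circ> ?t = ?r ^^ ((n - 1) * m)"
    using c'[of m] by (auto simp: fun_eq_iff funpow_mult mult.commute)
  then show ?thesis by (auto simp: cyc_group_def)
qed

text \<open>Exchanging the two index tuples reindexes \<open>x @ y\<close> by
  \<open>swap_half k\<close>, so the permutation acts on the transpose through its
  conjugate.\<close>

lemma ctrans_mperm:
  fixes G :: "'a graph"
  assumes s: "\<sigma> permutes {0..<2*k}"
  shows "ctrans (mperm k G \<sigma> X) = mperm k G (swap_half k \<circ> \<sigma> \<circ> swap_half k) (ctrans X)"
proof (intro ext)
  fix x y :: "'a list"
  let ?t = "swap_half k"
  show "ctrans (mperm k G \<sigma> X) x y = mperm k G (?t \<circ> \<sigma> \<circ> ?t) (ctrans X) x y"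
  proof (cases "x \<in> idx k G \<and> y \<in> idx k G")
    case True
    then have l: "length x = k" "length y = k" by (auto simp: idx_def)
    have inv: "inv (?t \<circ> \<sigma> \<circ> ?t) = ?t \<circ> inv \<sigma> \<circ> ?t"
      by (rule inv_equality) (use permutes_inverses[OF s] in auto)
    have mem: "inv \<sigma> i < 2 * k \<longleftrightarrow> i < 2 * k" for i
      using permutes_in_image[OF permutes_inv[OF s], of i] by auto
    let ?w = "map (\<lambda>j. (y @ x) ! inv \<sigma> j) [0..<2*k]"
    let ?w' = "map (\<lambda>j. (x @ y) ! inv (?t \<circ> \<sigma> \<circ> ?t) j) [0..<2*k]"
    have e: "(x @ y) ! inv (?t \<circ> \<sigma> \<circ> ?t) j = (y @ x) ! inv \<sigma> (?t j)" if "j < 2 * k" for j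
      using nth_append_swap_half[OF l, of "inv \<sigma> (?t j)"] that by (simp add: inv mem)
    have "drop k ?w' = take k ?w" "take k ?w' = drop k ?w"
      by (auto simp: list_eq_iff_nth_eq e swap_half_def add.commute)
    then show ?thesis using True by (simp add: mperm_def ctrans_def Let_def)
  qed (auto simp: mperm_def ctrans_def)
qed

lemma ctrans_mmult: "ctrans (mmult k G X Y) = mmult k G (ctrans Y) (ctrans X)"
  by (auto simp: fun_eq_iff ctrans_def mmult_def mult.commute)

lemma ctrans_hadamard: "ctrans (hadamard X Y) = hadamard (ctrans X) (ctrans Y)"
  by (auto simp: fun_eq_iff ctrans_def hadamard_def)

section \<open>Transposes of bilabelled graphs\<close>

text \<open>The vertices are renamed as well because \<open>C_blg k\<close> and
  \<open>M_blg k\<close> have fixed vertex names: for f = \<open>swap_half k\<close> each of them is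
  returned as the same record.\<close>

definition btrans :: "(nat \<Rightarrow> nat) \<Rightarrow> blg \<Rightarrow> blg" where
  "btrans f F = \<lparr>bgraph = map_graph f (bgraph F), inl = map f (outl F), outl = map f (inl F)\<rparr>"

text \<open>An injective renaming does not change the number of homomorphisms, and since counts are
  real, conjugation leaves the entries alone.\<close>

lemma hmat_btrans:
  fixes G :: "'a graph"
  assumes f: "inj f" and F: "wf_blg k F"
  shows "hmat k G (btrans f F) = ctrans (hmat k G F)"
proof (intro ext)
  fix x y :: "'a list"
  let ?V = "gverts (bgraph F)" and ?E = "gedges (bgraph F)"
  let ?A = "homs (map_graph f (bgraph F)) G" and ?B = "homs (bgraph F) G"
  have EV: "\<forall>e\<in>?E. e \<subseteq> ?V" using wf_blgD(2)[OF F] by blast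
  then have EV': "\<forall>e\<in>gedges (map_graph f (bgraph F)). e \<subseteq> gverts (map_graph f (bgraph F))"
    by (auto simp: map_graph_def)
  let ?j = "\<lambda>g. restrict (g \<circ> f) ?V"
  have "bij_betw ?j ?A ?B"
  proof (rule bij_betw_byWitness[where f' = "\<lambda>h. restrict (h \<circ> inv f) (f ` ?V)"])
    show "\<forall>g\<in>?A. restrict (?j g \<circ> inv f) (f ` ?V) = g"
    proof
      fix g assume g: "g \<in> ?A"
      have "restrict (?j g \<circ> inv f) (f ` ?V) v = g v" for v
        using f hom_undefined[OF g, of v] by (cases "v \<in> f ` ?V") (auto simp: map_graph_def)
      then show "restrict (?j g \<circ> inv f) (f ` ?V) = g" ..
    qed
    show "\<forall>h\<in>?B. ?j (restrict (h \<circ> inv f) (f ` ?V)) = h"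
      using f by (auto simp: fun_eq_iff restrict_def inj_image_mem_iff dest: hom_undefined)
    show "?j ` ?A \<subseteq> ?B"
    proof (rule image_subsetI)
      fix g assume g: "g \<in> ?A"
      show "?j g \<in> ?B"
      proof (rule restrict_hom[OF EV])
        show "(g \<circ> f) v \<in> gverts G" if "v \<in> ?V" for v
          using hom_vert[OF g, of "f v"] that by (auto simp: map_graph_def)
        show "(g \<circ> f) ` e \<in> gedges G" if "e \<in> ?E" for e
          using hom_edge[OF g, of "f ` e"] that by (auto simp: map_graph_def image_comp)
      qed
    qed
    show "(\<lambda>h. restrict (h \<circ> inv f) (f ` ?V)) ` ?B \<subseteq> ?A"
    proof (rule image_subsetI)
      fix h assume h: "h \<in> ?B"
      have "restrict (h \<circ> inv f) (gverts (map_graph f (bgraph F))) \<in> ?A"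
      proof (rule restrict_hom[OF EV'])
        show "(h \<circ> inv f) v \<in> gverts G" if "v \<in> gverts (map_graph f (bgraph F))" for v
          using hom_vert[OF h] that f by (auto simp: map_graph_def)
        show "(h \<circ> inv f) ` e \<in> gedges G" if "e \<in> gedges (map_graph f (bgraph F))" for e
          using hom_edge[OF h] that f by (auto simp: map_graph_def image_comp comp_def)
      qed
      then show "restrict (h \<circ> inv f) (f ` ?V) \<in> ?A" by (simp add: map_graph_def)
    qed
  qed
  note b = card_bij_Collect[OF this, of "\<lambda>h. map h (inl F) = y \<and> map h (outl F) = x"]
  have "map (?j g) (inl F) = map g (map f (inl F))" "map (?j g) (outl F) = map g (map f (outl F))" for g :: "nat \<Rightarrow> 'a"
    using wf_blgD(5,6)[OF F] by auto
  then have "card {g \<in> ?A. map g (map f (inl F)) = y \<and> map g (map f (outl F)) = x} = card {h \<in> ?B. map h (inl F) = y \<and> map h (outl F) = x}"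
    using b by (simp only:)
  then show "hmat k G (btrans f F) x y = ctrans (hmat k G F) x y"
    by (auto simp: hmat_def ctrans_def btrans_def conj_commute)
qed

text \<open>Each minor operation commutes with an injective renaming, because distinct vertices and
  distinct edges stay apart when one of them is removed.\<close>

lemma bminor_btrans:
  assumes f: "inj f" and "bminor B F"
  shows "bminor (btrans f B) (btrans f F)"
  using assms(2)
proof induction
  case refl then show ?case by (rule bminor.refl)
next
  case (contract F a b)
  let ?c = "\<lambda>x. if x = b then a else x" and ?d = "\<lambda>x. if x = f b then f a else x"
  have fc: "f \<circ> ?c = ?d \<circ> f" using f by (auto simp: fun_eq_iff inj_eq)
  have "(\<lambda>e. f ` ?c ` e) ` (gedges (bgraph F) - {{a, b}}) = (\<lambda>e. ?d ` f ` e) ` (gedges (bgraph F) - {{a, b}})"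
  proof (rule image_cong)
    show "f ` ?c ` e = ?d ` f ` e" for e by (simp only: image_comp fc)
  qed simp
  also have "\<dots> = (\<lambda>e. ?d ` e) ` ((\<lambda>e. f ` e) ` gedges (bgraph F) - {{f a, f b}})"
  proof -
    have "(\<lambda>e. f ` e) ` (gedges (bgraph F) - {{a, b}}) = (\<lambda>e. f ` e) ` gedges (bgraph F) - (\<lambda>e. f ` e) ` {{a, b}}"
      using f by (intro image_set_diff) (simp add: inj_image_eq_iff inj_def)
    then have "(\<lambda>e. f ` e) ` gedges (bgraph F) - {{f a, f b}} = (\<lambda>e. f ` e) ` (gedges (bgraph F) - {{a, b}})"
      by simp
    then show ?thesis by (simp only: image_image)
  qed
  finally have "btrans f (contract_edge a b F) = contract_edge (f a) (f b) (btrans f F)"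
    using f fc by (simp add: btrans_def contract_edge_def map_graph_def Let_def image_set_diff image_image)
  moreover have "{f a, f b} \<in> gedges (bgraph (btrans f F))"
    using imageI[OF contract.hyps(3), of "\<lambda>e. f ` e"] by (simp add: btrans_def map_graph_def)
  ultimately show ?case
    using bminor.contract[OF contract.IH, of "f a" "f b"] contract.hyps(2) inj_eq[OF f] by metis
next
  case (del_edge F e)
  have "btrans f (delete_edge e F) = delete_edge (f ` e) (btrans f F)"
  proof -
    have "(\<lambda>e. f ` e) ` (gedges (bgraph F) - {e}) = (\<lambda>e. f ` e) ` gedges (bgraph F) - (\<lambda>e. f ` e) ` {e}"
      using f by (intro image_set_diff) (simp add: inj_image_eq_iff inj_def)
    then show ?thesis by (simp add: btrans_def delete_edge_def map_graph_def)
  qed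
  then show ?case
    using bminor.del_edge[OF del_edge.IH, of "f ` e"] del_edge.hyps by (simp add: btrans_def map_graph_def)
next
  case (del_vertex F x)
  have "btrans f (delete_vertex x F) = delete_vertex (f x) (btrans f F)"
    using f by (auto simp: btrans_def delete_vertex_def map_graph_def image_set_diff inj_image_mem_iff inj_eq)
  then show ?case
    using bminor.del_vertex[OF del_vertex.IH, of "f x"] del_vertex.hyps f
    by (auto simp: btrans_def map_graph_def inj_image_mem_iff inj_eq)
qed

lemma involution_image_eqI:
  assumes "\<And>x. f (f x) = x" "\<And>x. x \<in> A \<Longrightarrow> f x \<in> A"
  shows "f ` A = A"
proof
  show "A \<subseteq> f ` A" using assms by (metis image_eqI subsetI)
qed (use assms(2) in blast)

lemma swap_half_image: "swap_half k ` {0..<2*k} = {0..<2*k}"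
  by (rule involution_image_eqI) auto

lemma swap_half_upt: "map (swap_half k) [0..<k] = [k..<2*k]" "map (swap_half k) [k..<2*k] = [0..<k]"
  by (auto simp: list_eq_iff_nth_eq swap_half_def)

text \<open>The reflection exchanges the path of in-labels with the path of out-labels and reverses
  the two end edges.\<close>

lemma btrans_C_blg:
  assumes "k \<ge> 1"
  shows "btrans (swap_half k) (C_blg k) = C_blg k"
proof -
  have "(\<lambda>e. swap_half k ` e) ` gedges (bgraph (C_blg k)) = gedges (bgraph (C_blg k))"
  proof (rule involution_image_eqI)
    show "swap_half k ` swap_half k ` e = e" for e by (simp add: image_image)
    fix e assume "e \<in> gedges (bgraph (C_blg k))"
    then consider i where "e = {i, i + 1}" "i < 2 * k" "i \<noteq> k - 1" "i \<noteq> 2 * k - 1" | "e = {0, k}" | "e = {k - 1, 2 * k - 1}"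
      by (auto simp: C_blg_def)
    then show "swap_half k ` e \<in> gedges (bgraph (C_blg k))"
    proof cases
      case 1
      let ?i = "swap_half k i"
      have "?i < 2 * k" "?i \<noteq> k - 1" "?i \<noteq> 2 * k - 1" "swap_half k (i + 1) = ?i + 1"
        using 1 by (auto simp: swap_half_def)
      then show ?thesis using 1 unfolding C_blg_def by auto
    next
      case 2
      then have "swap_half k ` e = {0, k}" using assms by (auto simp: swap_half_def)
      then show ?thesis by (simp add: C_blg_def)
    next
      case 3
      have "swap_half k (k - 1) = 2 * k - 1" "swap_half k (2 * k - 1) = k - 1"
        using assms by (auto simp: swap_half_def)
      then have "swap_half k ` e = {k - 1, 2 * k - 1}" using 3 by auto
      then show ?thesis by (simp add: C_blg_def)
    qed
  qed
  then show ?thesis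
    by (simp add: btrans_def map_graph_def swap_half_image swap_half_upt C_blg_def)
qed

lemma btrans_M_blg: "btrans (swap_half k) (M_blg k) = M_blg k"
proof -
  have "swap_half k ` {i, i + k} = {i, i + k}" if "i < k" for i
    using that by (auto simp: swap_half_def)
  then have "(\<lambda>e. swap_half k ` e) ` {{i, i + k} |i. i < k} = {{i, i + k} |i. i < k}"
    by (intro involution_image_eqI) (auto simp: image_image)
  then show ?thesis
    by (simp add: btrans_def map_graph_def swap_half_image swap_half_upt M_blg_def)
qed

lemma QP_btrans: "k \<ge> 1 \<Longrightarrow> F \<in> QP k \<Longrightarrow> btrans (swap_half k) F \<in> QP k"
  using bminor_btrans[OF inj_swap_half, of "C_blg k" F k] btrans_C_blg by (simp add: QP_def)

lemma QS_btrans: "F \<in> QS k \<Longrightarrow> btrans (swap_half k) F \<in> QS k"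
  using bminor_btrans[OF inj_swap_half, of "M_blg k" F k] btrans_M_blg by (simp add: QS_def)

text \<open>The transpose follows the construction of F: series factors change order, the cycle
  minor is transposed by renaming, and a rotation is replaced by its conjugate. One F' must serve
  both G and H, since the span is generated by pairs of matrices of the same pattern graph.\<close>

lemma PP_ctrans:
  fixes G :: "'a graph" and H :: "'b graph"
  assumes k: "k \<ge> 1" and G: "finite (gverts G)" and H: "finite (gverts H)" and "F \<in> PP k"
  shows "\<exists>F'\<in>PP k. hmat k G F' = ctrans (hmat k G F) \<and> hmat k H F' = ctrans (hmat k H F)"
  using assms(4)
proof induction
  case (base F)
  then have "btrans (swap_half k) F \<in> Q k"
    using QP_btrans[OF k] QS_btrans by (auto simp: Q_def)
  then show ?case
    using hmat_btrans[where G = G, OF inj_swap_half[of k] wf_Q[OF k base]] hmat_btrans[where G = H, OF inj_swap_half[of k] wf_Q[OF k base]]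
    by (intro bexI[of _ "btrans (swap_half k) F"] PP.base) simp_all
next
  case (ser F1 F2)
  then obtain F1' F2' where F': "F1' \<in> PP k" "F2' \<in> PP k"
    "hmat k G F1' = ctrans (hmat k G F1)" "hmat k H F1' = ctrans (hmat k H F1)"
    "hmat k G F2' = ctrans (hmat k G F2)" "hmat k H F2' = ctrans (hmat k H F2)" by blast
  then show ?case
    using ser.hyps G H PP.ser[OF F'(2,1)]
    by (intro bexI[of _ "series F2' F1'"]) (auto simp: hmat_series wf_PP[OF k] ctrans_mmult)
next
  case (par F1 F2)
  then obtain F1' where F': "F1' \<in> PP k"
    "hmat k G F1' = ctrans (hmat k G F1)" "hmat k H F1' = ctrans (hmat k H F1)" by blast
  have w: "wf_blg k F2" using wf_Q[OF k QP_subset_Q] par.hyps by blast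
  note Q2 = QP_btrans[OF k par.hyps(2)]
  have w': "wf_blg k (btrans (swap_half k) F2)" using wf_Q[OF k QP_subset_Q] Q2 by blast
  show ?case
    using par.hyps F' PP.par[OF F'(1) Q2] w w'
    by (intro bexI[of _ "parallel F1' (btrans (swap_half k) F2)"])
      (auto simp: hmat_parallel wf_PP[OF k] ctrans_hadamard hmat_btrans[OF inj_swap_half])
next
  case (perm F \<sigma>)
  then obtain F' where F': "F' \<in> PP k"
    "hmat k G F' = ctrans (hmat k G F)" "hmat k H F' = ctrans (hmat k H F)" by blast
  let ?s = "swap_half k \<circ> \<sigma> \<circ> swap_half k"
  have s: "?s \<in> cyc_group k" using swap_half_conj_cyc_group[OF k perm.hyps(2)] .
  show ?case
    using perm.hyps F' PP.perm[OF F'(1) s] cyc_group_permutes[OF k s] cyc_group_permutes[OF k perm.hyps(2)]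
    by (intro bexI[of _ "bperm k ?s F'"]) (auto simp: hmat_bperm wf_PP[OF k] ctrans_mperm)
qed

subsection \<open>Equality patterns as minors\<close>

lemma bminor_trans:
  assumes "bminor F F'" "bminor B F"
  shows "bminor B F'"
  using assms by induction (auto intro: bminor.intros)

text \<open>The second clause says that x and f x lie in the same component of (nat, S); quantifying over
  boolean labellings instead of paths makes it stable under contraction.\<close>

definition collapses :: "nat set set \<Rightarrow> (nat \<Rightarrow> nat) \<Rightarrow> bool" where
  "collapses S f \<longleftrightarrow> (\<forall>e\<in>S. \<forall>a\<in>e. \<forall>b\<in>e. f a = f b) \<and>
     (\<forall>(p :: nat \<Rightarrow> bool) x. (\<forall>e\<in>S. \<forall>a\<in>e. \<forall>b\<in>e. p a = p b) \<longrightarrow> p (f x) = p x)"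

text \<open>The edges outside S are deleted first and the others then contracted one by one. The
  order matters: a contraction could give an edge of S and an edge outside S the same image. Once S
  is the whole edge set, the recursion can continue with all remaining edges.\<close>

lemma contraction_minor:
  assumes "wf_blg k F" "S \<subseteq> gedges (bgraph F)" "finite (gedges (bgraph F))"
    "\<forall>e\<in>gedges (bgraph F). \<exists>a b. a \<noteq> b \<and> e = {a, b}"
  shows "\<exists>F' f. bminor F F' \<and>
     bgraph F' = \<lparr>gverts = f ` gverts (bgraph F), gedges = {}\<rparr> \<and>
     inl F' = map f (inl F) \<and> outl F' = map f (outl F) \<and> collapses S f"
  using assms
proof (induction "card (gedges (bgraph F))" arbitrary: F S rule: less_induct)
  case less
  let ?E = "gedges (bgraph F)"
  consider "?E = {}" | e where "e \<in> ?E" "e \<notin> S" | "S = ?E" "?E \<noteq> {}" using less.prems(2) by blast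
  then show ?case
  proof cases
    case 1
    then have "bgraph F = \<lparr>gverts = (\<lambda>x. x) ` gverts (bgraph F), gedges = {}\<rparr>" "S = {}"
      using less.prems(2) by (auto intro: graph.equality)
    then show ?thesis by (intro exI[of _ F] exI[of _ "\<lambda>x. x"]) (simp add: bminor.refl collapses_def)
  next
    case 2
    let ?D = "delete_edge e F"
    have D: "bminor F ?D" using 2 by (intro bminor.del_edge bminor.refl)
    have lt: "card (gedges (bgraph ?D)) < card ?E"
      using card_Diff1_less[OF less.prems(3) 2(1)] by (simp add: delete_edge_def)
    have "S \<subseteq> gedges (bgraph ?D)" "finite (gedges (bgraph ?D))" "\<forall>e\<in>gedges (bgraph ?D). \<exists>a b. a \<noteq> b \<and> e = {a, b}"
      using 2 less.prems by (auto simp: delete_edge_def)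
    note IH = less.hyps[OF lt wf_bminor[OF D less.prems(1)] this]
    have DV: "gverts (bgraph ?D) = gverts (bgraph F)" "inl ?D = inl F" "outl ?D = outl F"
      by (simp_all add: delete_edge_def)
    from IH
    obtain F' f where "bminor ?D F'" and *: "bgraph F' = \<lparr>gverts = f ` gverts (bgraph F), gedges = {}\<rparr>"
     "inl F' = map f (inl F)" "outl F' = map f (outl F)"
     "collapses S f"
      unfolding DV by blast
    then have "bminor F F'" using bminor_trans[OF _ D] by blast
    with * show ?thesis by blast
  next
    case 3
    from 3(2) obtain e where e: "e \<in> ?E" by blast
    from bspec[OF less.prems(4) e] obtain a b where "a \<noteq> b" "e = {a, b}" by (elim exE conjE)
    with e have ab: "a \<noteq> b" "{a, b} \<in> ?E" by simp_all
    let ?c = "\<lambda>x. if x = b then a else x"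
    let ?D = "contract_edge a b F"
    have D: "bminor F ?D" using ab by (intro bminor.contract bminor.refl)
    have EV: "gedges (bgraph ?D) = (\<lambda>e. ?c ` e) ` (?E - {{a, b}})"
        "gverts (bgraph ?D) = gverts (bgraph F) - {b}"
        "inl ?D = map ?c (inl F)" "outl ?D = map ?c (outl F)"
      by (simp_all add: contract_edge_def Let_def)
    have cV: "gverts (bgraph F) - {b} = ?c ` gverts (bgraph F)"
      using ab wf_blgD(2)[OF less.prems(1) ab(2)] by (auto simp: image_def)
    have "card (gedges (bgraph ?D)) \<le> card (?E - {{a, b}})"
      unfolding EV using less.prems(3) by (intro card_image_le) simp
    also have "\<dots> < card ?E" using less.prems(3) ab(2) by (meson card_Diff1_less)
    finally have lt: "card (gedges (bgraph ?D)) < card ?E" .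
    have fin: "finite (gedges (bgraph ?D))" unfolding EV using less.prems(3) by simp
    \<comment> \<open>Among two-element edges only {a, b} would become a loop, and the contraction
      removes it.\<close>
    have sz: "\<forall>e\<in>gedges (bgraph ?D). \<exists>a b. a \<noteq> b \<and> e = {a, b}"
    proof
      fix e assume "e \<in> gedges (bgraph ?D)"
      then obtain e' where e': "e' \<in> ?E" "e' \<noteq> {a, b}" "e = ?c ` e'" unfolding EV by blast
      from bspec[OF less.prems(4) e'(1)] obtain u v where uv: "u \<noteq> v" "e' = {u, v}" by (elim exE conjE)
      have "?c u \<noteq> ?c v" using uv e'(2) by (auto split: if_splits)
      moreover have "e = {?c u, ?c v}" unfolding e'(3) uv(2) by (simp only: image_insert image_empty)
      ultimately show "\<exists>a b. a \<noteq> b \<and> e = {a, b}" by blast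
    qed
    from less.hyps[OF lt wf_bminor[OF D less.prems(1)] subset_refl fin sz]
    obtain F' f where "bminor ?D F'" and *: "bgraph F' = \<lparr>gverts = f ` ?c ` gverts (bgraph F), gedges = {}\<rparr>"
     "inl F' = map f (map ?c (inl F))" "outl F' = map f (map ?c (outl F))"
     and f: "collapses (gedges (bgraph ?D)) f"
      unfolding EV(2-4) cV by blast
    from f have f1: "\<forall>e\<in>gedges (bgraph ?D). \<forall>a\<in>e. \<forall>b\<in>e. f a = f b"
      and f2: "\<forall>(p :: nat \<Rightarrow> bool) x. (\<forall>e\<in>gedges (bgraph ?D). \<forall>a\<in>e. \<forall>b\<in>e. p a = p b) \<longrightarrow> p (f x) = p x"
      unfolding collapses_def by (rule conjunct1, rule conjunct2)
    have m: "bminor F F'" using bminor_trans[OF \<open>bminor ?D F'\<close> D] .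
    have g1: "f (?c u) = f (?c v)" if "e \<in> S" "u \<in> e" "v \<in> e" for e u v
    proof (cases "e = {a, b}")
      case True then show ?thesis using that by auto
    next
      case False
      then have "?c ` e \<in> gedges (bgraph ?D)" using that(1) 3(1) unfolding EV(1) by blast
      from f1[rule_format, OF this imageI[OF that(2)] imageI[OF that(3)]] show ?thesis .
    qed
    \<comment> \<open>A labelling constant on the edges of S does not distinguish a from b, so
      contraction leaves its values unchanged and it is constant on the contracted edges
      too.\<close>
    have g2: "p (f (?c x)) = p x" if p: "\<forall>e\<in>S. \<forall>a\<in>e. \<forall>b\<in>e. p a = p b" for p :: "nat \<Rightarrow> bool" and x
    proof -
      have "p a = p b" using p[rule_format, of "{a, b}" a b] ab 3(1) by simp
      then have c: "p (?c u) = p u" for u by simp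
      have "\<forall>e\<in>gedges (bgraph ?D). \<forall>a\<in>e. \<forall>b\<in>e. p a = p b"
      proof (intro ballI)
        fix e u v assume "e \<in> gedges (bgraph ?D)" "u \<in> e" "v \<in> e"
        then obtain e' where "e' \<in> ?E" "u \<in> ?c ` e'" "v \<in> ?c ` e'" unfolding EV(1) by blast
        then obtain u' v' where "e' \<in> ?E" "u' \<in> e'" "v' \<in> e'" "u = ?c u'" "v = ?c v'" by (elim imageE)
        then have "p u' = p v'" using p[rule_format, of e' u' v'] 3(1) by simp
        then show "p u = p v" unfolding \<open>u = ?c u'\<close> \<open>v = ?c v'\<close> c .
      qed
      then have "p (f (?c x)) = p (?c x)" by (rule f2[THEN spec, THEN spec, THEN mp])
      then show ?thesis unfolding c .
    qed
    show ?thesis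
    proof (intro exI[of _ F'] exI[of _ "\<lambda>x. f (?c x)"] conjI)
      show "bgraph F' = \<lparr>gverts = (\<lambda>x. f (?c x)) ` gverts (bgraph F), gedges = {}\<rparr>"
        unfolding * image_image ..
      show "inl F' = map (\<lambda>x. f (?c x)) (inl F)" "outl F' = map (\<lambda>x. f (?c x)) (outl F)"
        unfolding * by simp_all
      show "collapses S (\<lambda>x. f (?c x))"
        unfolding collapses_def using g1 g2 by (intro conjI ballI allI impI)
    qed (rule m)
  qed
qed

text \<open>The vertices of \<open>C_blg k\<close> and \<open>M_blg k\<close> are the label
  positions themselves, so an edge {a, b} can be read as an equation between entries a and b of
  \<open>x @ y\<close>.\<close>

definition eqmat :: "nat \<Rightarrow> 'a graph \<Rightarrow> nat set set \<Rightarrow> 'a mat" where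
  "eqmat k G S x y = (if x \<in> idx k G \<and> y \<in> idx k G \<and>
      (\<forall>e\<in>S. \<forall>a\<in>e. \<forall>b\<in>e. (x @ y) ! a = (x @ y) ! b) then 1 else 0)"

text \<open>Every vertex of F carries a label, so x and y leave at most one homomorphism. As F has
  no edges, the only condition for its existence is that entries at merged positions agree.\<close>

lemma hmat_contraction:
  fixes G :: "'a graph"
  assumes F: "bgraph F = \<lparr>gverts = f ` {0..<2*k}, gedges = {}\<rparr>"
     "inl F = map f [0..<k]" "outl F = map f [k..<2*k]"
    and f: "collapses S f"
    and S: "\<forall>e\<in>S. e \<subseteq> {0..<2*k}"
  shows "hmat k G F = eqmat k G S"
proof (intro ext)
  from f have f1: "\<forall>e\<in>S. \<forall>a\<in>e. \<forall>b\<in>e. f a = f b"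
    and f2: "\<forall>(p :: nat \<Rightarrow> bool) x. (\<forall>e\<in>S. \<forall>a\<in>e. \<forall>b\<in>e. p a = p b) \<longrightarrow> p (f x) = p x"
    unfolding collapses_def by (rule conjunct1, rule conjunct2)
  fix x y :: "'a list"
  show "hmat k G F x y = eqmat k G S x y"
  proof (cases "x \<in> idx k G \<and> y \<in> idx k G")
    case True
    then have l: "length x = k" "length y = k" and xy: "set (x @ y) \<subseteq> gverts G" by (auto simp: idx_def)
    define z where "z = x @ y"
    let ?A = "{h \<in> homs (bgraph F) G. map h (inl F) = x \<and> map h (outl F) = y}"
    have zG: "z ! i \<in> gverts G" if "i < 2 * k" for i
    proof -
      have "z ! i \<in> set z" using that l by (intro nth_mem) (simp add: z_def)
      then show ?thesis using xy unfolding z_def by blast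
    qed
    have A: "h \<in> ?A \<longleftrightarrow> h \<in> homs (bgraph F) G \<and> (\<forall>i<2*k. h (f i) = z ! i)" for h
    proof -
      have "map h (inl F) = x \<and> map h (outl F) = y \<longleftrightarrow> map h (inl F) @ map h (outl F) = z"
        using l by (simp add: F z_def)
      also have "map h (inl F) @ map h (outl F) = map (h \<circ> f) [0..<2*k]"
        by (simp add: F mult_2 flip: map_append upt_add_eq_append)
      also have "\<dots> = z \<longleftrightarrow> (\<forall>i<2*k. h (f i) = z ! i)"
        using l by (simp add: list_eq_iff_nth_eq z_def)
      finally show ?thesis by blast
    qed
    show ?thesis
    proof (cases "\<forall>e\<in>S. \<forall>a\<in>e. \<forall>b\<in>e. z ! a = z ! b")
      case z: True
      \<comment> \<open>The labelling clause of \<open>collapses\<close> is applied to the predicate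
        of having the same entry as position i.\<close>
      have zf: "z ! (f i) = z ! i" for i
      proof -
        have "\<forall>e\<in>S. \<forall>a\<in>e. \<forall>b\<in>e. (z ! a = z ! i) = (z ! b = z ! i)"
        proof (intro ballI)
          fix e a b assume "e \<in> S" "a \<in> e" "b \<in> e"
          then have "z ! a = z ! b" by (rule z[rule_format])
          then show "(z ! a = z ! i) = (z ! b = z ! i)" by (simp only:)
        qed
        then have "(z ! f i = z ! i) = (z ! i = z ! i)" by (rule f2[THEN spec, THEN spec, THEN mp])
        then show ?thesis by simp
      qed
      \<comment> \<open>By \<open>zf\<close> a representative v carries the common entry of its
        class, which forces the value z ! v.\<close>
      have "?A = {restrict (\<lambda>v. z ! v) (f ` {0..<2*k})}"
      proof (intro equalityI subsetI)
        fix h assume "h \<in> ?A"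
        then have h: "h \<in> homs (bgraph F) G" "\<forall>i<2*k. h (f i) = z ! i" unfolding A by auto
        have "h v = restrict (\<lambda>v. z ! v) (f ` {0..<2*k}) v" for v
          using h zf hom_undefined[OF h(1), of v] by (cases "v \<in> f ` {0..<2*k}") (auto simp: F)
        then show "h \<in> {restrict (\<lambda>v. z ! v) (f ` {0..<2*k})}" by blast
      next
        fix h assume "h \<in> {restrict (\<lambda>v. z ! v) (f ` {0..<2*k})}"
        then have h: "h = restrict (\<lambda>v. z ! v) (f ` {0..<2*k})" by simp
        show "h \<in> ?A" unfolding A unfolding h homs_def F using zG zf by auto
      qed
      then have "hmat k G F x y = 1" using True by (simp only: hmat_def) simp
      moreover have "eqmat k G S x y = 1"
        unfolding eqmat_def by (rule if_P) (use True z[unfolded z_def] in blast)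
      ultimately show ?thesis by (simp only:)
    next
      case z: False
      have "?A = {}"
      proof (rule ccontr)
        assume "?A \<noteq> {}"
        then obtain h where h: "\<forall>i<2*k. h (f i) = z ! i" using A by blast
        have "z ! a = z ! b" if "e \<in> S" "a \<in> e" "b \<in> e" for e a b
        proof -
          have "e \<subseteq> {0..<2*k}" using S that(1) by blast
          then have "a < 2 * k" "b < 2 * k" using that(2,3) by auto
          moreover have "f a = f b" using that by (rule f1[rule_format])
          ultimately show ?thesis using h by metis
        qed
        then show False using z by blast
      qed
      then have "hmat k G F x y = 0" using True by (simp only: hmat_def) simp
      moreover have "eqmat k G S x y = 0"
        unfolding eqmat_def by (rule if_not_P) (use z[unfolded z_def] in blast)
      ultimately show ?thesis by (simp only:)
    qed
  qed (auto simp: hmat_def eqmat_def)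
qed

lemma eqmat_minor:
  fixes G :: "'a graph" and H :: "'b graph"
  assumes B: "wf_blg k B" "gverts (bgraph B) = {0..<2*k}" "inl B = [0..<k]" "outl B = [k..<2*k]"
    "\<forall>e\<in>gedges (bgraph B). \<exists>a b. a \<noteq> b \<and> e = {a, b}" and S: "S \<subseteq> gedges (bgraph B)"
  shows "\<exists>F. bminor B F \<and> hmat k G F = eqmat k G S \<and> hmat k H F = eqmat k H S"
proof -
  have sub: "\<forall>e\<in>gedges (bgraph B). e \<subseteq> {0..<2*k}" using wf_blgD(2)[OF B(1)] B(2) by blast
  then have "gedges (bgraph B) \<subseteq> Pow {0..<2*k}" by blast
  then have "finite (gedges (bgraph B))" by (rule finite_subset) simp
  from contraction_minor[OF B(1) S this B(5)] obtain F f where F: "bminor B F"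
     "bgraph F = \<lparr>gverts = f ` {0..<2*k}, gedges = {}\<rparr>"
     "inl F = map f [0..<k]" "outl F = map f [k..<2*k]"
     "collapses S f"
    unfolding B by blast
  have "\<forall>e\<in>S. e \<subseteq> {0..<2*k}" using S sub by blast
  then show ?thesis using F(1) hmat_contraction[where G = G, OF F(2-5)] hmat_contraction[where G = H, OF F(2-5)] by blast
qed

lemma eqmat_QP:
  fixes G :: "'a graph" and H :: "'b graph"
  assumes "k \<ge> 1" "S \<subseteq> gedges (bgraph (C_blg k))"
  shows "\<exists>F\<in>QP k. hmat k G F = eqmat k G S \<and> hmat k H F = eqmat k H S"
proof -
  have "\<exists>a b. a \<noteq> b \<and> e = {a, b}" if "e \<in> gedges (bgraph (C_blg k))" for e
  proof -
    from that consider i where "e = {i, i + 1}" | "e = {0, k}" | "e = {k - 1, 2 * k - 1}"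
      by (auto simp: C_blg_def)
    then show ?thesis
    proof cases
      case 1 then show ?thesis by (metis n_not_Suc_n Suc_eq_plus1)
    next
      case 2 with assms(1) have "0 \<noteq> k" by simp
      with 2 show ?thesis by blast
    next
      case 3 with assms(1) have "k - 1 \<noteq> 2 * k - 1" by simp
      with 3 show ?thesis by blast
    qed
  qed
  then show ?thesis
    using eqmat_minor[OF wf_C_blg[OF assms(1)] _ _ _ _ assms(2), of G H]
    by (simp add: QP_def Bex_def) (simp add: C_blg_def)
qed

lemma eqmat_QS:
  fixes G :: "'a graph" and H :: "'b graph"
  assumes "k \<ge> 1" "S \<subseteq> gedges (bgraph (M_blg k))"
  shows "\<exists>F\<in>QS k. hmat k G F = eqmat k G S \<and> hmat k H F = eqmat k H S"
proof -
  have "\<forall>e\<in>gedges (bgraph (M_blg k)). \<exists>a b. a \<noteq> b \<and> e = {a, b}"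
  proof
    fix e assume "e \<in> gedges (bgraph (M_blg k))"
    then obtain i where "e = {i, i + k}" by (auto simp: M_blg_def)
    moreover have "i \<noteq> i + k" using assms(1) by simp
    ultimately show "\<exists>a b. a \<noteq> b \<and> e = {a, b}" by blast
  qed
  then show ?thesis
    using eqmat_minor[OF wf_M_blg _ _ _ _ assms(2), of G H]
    by (simp add: QS_def Bex_def) (simp add: M_blg_def)
qed

subsection \<open>Traces as homomorphism counts\<close>

text \<open>Matrices are functions on all pairs of lists; vanishing off the index set lets equality
  of entries give equality of functions.\<close>

definition supported :: "nat \<Rightarrow> 'a graph \<Rightarrow> 'a mat \<Rightarrow> bool" where
  "supported k G X \<longleftrightarrow> (\<forall>x y. \<not> (x \<in> idx k G \<and> y \<in> idx k G) \<longrightarrow> X x y = 0)"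

section \<open>Pattern matrices for the trace\<close>

definition match_edges :: "nat \<Rightarrow> nat \<Rightarrow> nat set set" where
  "match_edges k j = {{i, i + k} |i. j \<le> i \<and> i < k}"

text \<open>The path j, ..., 0, k, ..., k + j around the cycle: it links left coordinate j to right
  coordinate j by a detour through the end edge {0, k}.\<close>

definition path_edges :: "nat \<Rightarrow> nat \<Rightarrow> nat set set" where
  "path_edges k j = {{i, i + 1} |i. i < j} \<union> {{k + i, k + i + 1} |i. i < j} \<union> {{0, k}}"

lemma match_edges_subset: "match_edges k j \<subseteq> gedges (bgraph (M_blg k))"
  by (auto simp: match_edges_def M_blg_def)

lemma path_edges_subset:
  assumes "j < k"
  shows "path_edges k j \<subseteq> gedges (bgraph (C_blg k))"
proof -
  have "{i, i + 1} \<in> gedges (bgraph (C_blg k))" if "i < 2 * k" "i \<noteq> k - 1" "i \<noteq> 2 * k - 1" for i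
    using that by (auto simp: C_blg_def)
  moreover have "i < 2 * k" "i \<noteq> k - 1" "i \<noteq> 2 * k - 1" if "i < j" for i
    using that assms by auto
  moreover have "k + i < 2 * k" "k + i \<noteq> k - 1" "k + i \<noteq> 2 * k - 1" if "i < j" for i
    using that assms by auto
  moreover have "{0, k} \<in> gedges (bgraph (C_blg k))" by (simp add: C_blg_def)
  ultimately show ?thesis unfolding path_edges_def by blast
qed

text \<open>Multiplying by this matrix keeps the coordinates from j on and sums over the first j, on
  either side. For j = 0 it is the identity.\<close>

lemma eqmat_match_edges:
  assumes "x \<in> idx k G" "y \<in> idx k G"
  shows "eqmat k G (match_edges k j) x y = (if drop j x = drop j y then 1 else 0)"
proof -
  have l: "length x = k" "length y = k" using assms by (auto simp: idx_def)
  have "(\<forall>e\<in>match_edges k j. \<forall>a\<in>e. \<forall>b\<in>e. (x @ y) ! a = (x @ y) ! b) \<longleftrightarrow>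
      (\<forall>i. j \<le> i \<and> i < k \<longrightarrow> (x @ y) ! i = (x @ y) ! (i + k))" (is "?L \<longleftrightarrow> ?R")
  proof
    assume L: ?L
    show ?R
    proof (intro allI impI)
      fix i assume "j \<le> i \<and> i < k"
      then have "{i, i + k} \<in> match_edges k j" by (auto simp: match_edges_def)
      from L[rule_format, OF this, of i "i + k"] show "(x @ y) ! i = (x @ y) ! (i + k)" by simp
    qed
  next
    assume R: ?R
    show ?L
    proof (intro ballI)
      fix e a b assume "e \<in> match_edges k j" and ab: "a \<in> e" "b \<in> e"
      then obtain i where i: "e = {i, i + k}" "j \<le> i \<and> i < k" unfolding match_edges_def by blast
      show "(x @ y) ! a = (x @ y) ! b"
        using R[rule_format, OF i(2)] ab unfolding i(1) by (elim insertE emptyE) (simp_all only:)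
    qed
  qed
  also have "\<dots> \<longleftrightarrow> (\<forall>i. j \<le> i \<and> i < k \<longrightarrow> x ! i = y ! i)"
    using l by (simp add: nth_append)
  also have "\<dots> \<longleftrightarrow> drop j x = drop j y"
  proof
    assume R: "\<forall>i. j \<le> i \<and> i < k \<longrightarrow> x ! i = y ! i"
    show "drop j x = drop j y"
      using l R by (intro nth_equalityI) auto
  next
    assume e: "drop j x = drop j y"
    show "\<forall>i. j \<le> i \<and> i < k \<longrightarrow> x ! i = y ! i"
    proof (intro allI impI)
      fix i assume "j \<le> i \<and> i < k"
      then show "x ! i = y ! i"
        using arg_cong[OF e, of "\<lambda>z. z ! (i - j)"] l by simp
    qed
  qed
  finally show ?thesis unfolding eqmat_def using assms by (simp only:) simp
qed

lemma eqmat_path_edges: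
  assumes "x \<in> idx k G" "y \<in> idx k G" "j < k"
  shows "eqmat k G (path_edges k j) x y =
    (if \<exists>w. take (Suc j) x = replicate (Suc j) w \<and> take (Suc j) y = replicate (Suc j) w then 1 else 0)"
proof -
  have l: "length x = k" "length y = k" using assms by (auto simp: idx_def)
  have "(\<forall>e\<in>path_edges k j. \<forall>a\<in>e. \<forall>b\<in>e. (x @ y) ! a = (x @ y) ! b) \<longleftrightarrow>
      (\<exists>w. take (Suc j) x = replicate (Suc j) w \<and> take (Suc j) y = replicate (Suc j) w)" (is "?L \<longleftrightarrow> ?R")
  proof
    assume L: ?L
    have x: "x ! i = x ! 0 \<and> y ! i = y ! 0" if "i \<le> j" for i
      using that
    proof (induction i)
      case (Suc i)
      then have "{i, i + 1} \<in> path_edges k j" "{k + i, k + i + 1} \<in> path_edges k j"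
        by (auto simp: path_edges_def)
      from L[rule_format, OF this(1), of i "i + 1"] L[rule_format, OF this(2), of "k + i" "k + i + 1"]
      have "x ! i = x ! Suc i" "y ! i = y ! Suc i" using l assms(3) Suc.prems by (auto simp: nth_append)
      then show ?case using Suc by simp
    qed simp
    have "{0, k} \<in> path_edges k j" by (auto simp: path_edges_def)
    from L[rule_format, OF this, of 0 k] have "x ! 0 = y ! 0"
      using l assms(3) by (simp add: nth_append)
    have "take (Suc j) z = replicate (Suc j) w" if "length z = k" "\<And>i. i \<le> j \<Longrightarrow> z ! i = w" for z w
    proof (rule nth_equalityI)
      show "length (take (Suc j) z) = length (replicate (Suc j) w)" using that(1) assms(3) by simp
      fix i assume "i < length (take (Suc j) z)"
      then have "i \<le> j" by simp
      with that(2)[OF this] show "take (Suc j) z ! i = replicate (Suc j) w ! i" by (simp del: replicate_Suc)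
    qed
    then have "take (Suc j) x = replicate (Suc j) (x ! 0)" "take (Suc j) y = replicate (Suc j) (x ! 0)"
      using l x \<open>x ! 0 = y ! 0\<close> by metis+
    then show ?R by blast
  next
    assume ?R
    then obtain w where w: "take (Suc j) x = replicate (Suc j) w" "take (Suc j) y = replicate (Suc j) w" by blast
    have "x ! i = w" "y ! i = w" if "i \<le> j" for i
      using arg_cong[OF w(1), of "\<lambda>z. z ! i"] arg_cong[OF w(2), of "\<lambda>z. z ! i"] that
      by (simp_all del: replicate_Suc)
    then have xw: "(x @ y) ! i = w" "(x @ y) ! (k + i) = w" if "i \<le> j" for i
      using that l assms(3) by (simp_all add: nth_append)
    have "(x @ y) ! a = w" if "e \<in> path_edges k j" "a \<in> e" for e a
    proof -
      from that(1) consider i where "i < j" "e = {i, i + 1}" | i where "i < j" "e = {k + i, k + i + 1}" | "e = {0, k}"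
        unfolding path_edges_def by blast
      then show ?thesis
        using that(2) xw(1)[of 0] xw(2)[of 0] by cases (use xw(1) xw(2)[of "Suc _"] xw(2) in auto)
    qed
    then show ?L by simp
  qed
  then show ?thesis unfolding eqmat_def using assms by (simp only:) simp
qed

section \<open>Partial traces\<close>

text \<open>The partial trace over the first j coordinates, tensored with the all-ones matrix in
  these coordinates so that it stays indexed by k-tuples. At j = k it is the trace times J.\<close>

definition ptrace :: "nat \<Rightarrow> 'a graph \<Rightarrow> nat \<Rightarrow> 'a mat \<Rightarrow> 'a mat" where
  "ptrace k G j X x y = (if x \<in> idx k G \<and> y \<in> idx k G then
      (\<Sum>z\<in>idx j G. X (z @ drop j x) (z @ drop j y)) else 0)"

lemma ptrace_0:
  assumes "supported k G X"
  shows "ptrace k G 0 X = X"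
proof -
  have "idx 0 G = {[]}" by (auto simp: idx_def)
  then show ?thesis using assms by (auto simp: fun_eq_iff ptrace_def supported_def)
qed

lemma ptrace_full:
  assumes "x \<in> idx k G" "y \<in> idx k G"
  shows "ptrace k G k X x y = mtrace k G X"
  using assms by (simp add: ptrace_def mtrace_def idx_def)

text \<open>The last coordinate is split off because it is the one that the step from j to
  \<open>Suc j\<close> adds to the partial trace.\<close>

lemma sum_idx_Suc:
  "(\<Sum>z\<in>idx (Suc j) G. f z) = (\<Sum>w\<in>gverts G. \<Sum>z\<in>idx j G. f (z @ [w]))"
proof -
  have i: "inj_on (\<lambda>p. snd p @ [fst p]) (gverts G \<times> idx j G)" by (auto simp: inj_on_def)
  have "idx (Suc j) G = (\<lambda>p. snd p @ [fst p]) ` (gverts G \<times> idx j G)"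
  proof (intro equalityI subsetI)
    fix z assume z: "z \<in> idx (Suc j) G"
    then have "z \<noteq> []" by (auto simp: idx_def)
    then have e: "z = butlast z @ [last z]" by simp
    moreover have "last z \<in> gverts G" using z \<open>z \<noteq> []\<close> by (auto simp: idx_def)
    moreover have "butlast z \<in> idx j G" using z by (auto simp: idx_def dest: in_set_butlastD)
    ultimately show "z \<in> (\<lambda>p. snd p @ [fst p]) ` (gverts G \<times> idx j G)" by force
  qed (auto simp: idx_def)
  then show ?thesis
    by (simp add: sum.reindex[OF i] sum.cartesian_product case_prod_unfold)
qed

text \<open>One coordinate of the trace at a time: a minor of the cycle may only identify consecutive labels,
  so the j coordinates already summed are freed by E on both sides and then reused to carry the
  identification of coordinate j on the left with coordinate j on the right.\<close>

lemma ptrace_Suc: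
  fixes G :: "'a graph"
  assumes G: "finite (gverts G)" and j: "j < k"
  defines "E \<equiv> eqmat k G (match_edges k (Suc j))"
  shows "ptrace k G (Suc j) X =
    mmult k G (mmult k G E (hadamard (ptrace k G j X) (eqmat k G (path_edges k j)))) E"
proof (intro ext)
  fix x y :: "'a list"
  let ?I = "idx k G" and ?R = "eqmat k G (path_edges k j)" and ?Y = "ptrace k G j X"
  show "ptrace k G (Suc j) X x y = mmult k G (mmult k G E (hadamard ?Y ?R)) E x y"
  proof (cases "x \<in> ?I \<and> y \<in> ?I")
    case True
    then have x: "x \<in> ?I" and y: "y \<in> ?I" by auto
    \<comment> \<open>The middle indices that contribute: E copies the tails of x and y, and the
      path pattern makes the first \<open>Suc j\<close> entries on both sides equal to one vertex
      w.\<close>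
    define c where "c = (\<lambda>w. replicate (Suc j) w @ drop (Suc j) x)"
    define d where "d = (\<lambda>w. replicate (Suc j) w @ drop (Suc j) y)"
    define T where "T = (\<lambda>u v. E x u * (?Y u v * ?R u v) * E v y)"
    have cd: "c w \<in> ?I" "d w \<in> ?I" if "w \<in> gverts G" for w
      using that x y j by (auto simp: c_def d_def idx_def dest: in_set_dropD)
    have inj: "inj_on (\<lambda>w. (d w, c w)) (gverts G)" by (auto simp: inj_on_def c_def d_def)
    have "mmult k G (mmult k G E (hadamard ?Y ?R)) E x y = (\<Sum>v\<in>?I. \<Sum>u\<in>?I. T u v)"
      using True by (simp add: mmult_def hadamard_def T_def sum_distrib_right)
    also have "\<dots> = (\<Sum>p\<in>?I \<times> ?I. T (snd p) (fst p))"
      by (simp add: sum.cartesian_product case_prod_unfold)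
    also have "\<dots> = (\<Sum>p\<in>(\<lambda>w. (d w, c w)) ` gverts G. T (snd p) (fst p))"
    proof (rule sum.mono_neutral_right)
      show "finite (?I \<times> ?I)" using finite_idx[OF G] by simp
      show "(\<lambda>w. (d w, c w)) ` gverts G \<subseteq> ?I \<times> ?I" using cd by auto
      show "\<forall>p\<in>?I \<times> ?I - (\<lambda>w. (d w, c w)) ` gverts G. T (snd p) (fst p) = 0"
      proof (rule ballI, rule ccontr)
        fix p assume p: "p \<in> ?I \<times> ?I - (\<lambda>w. (d w, c w)) ` gverts G" and nz: "T (snd p) (fst p) \<noteq> 0"
        obtain v u where vu: "p = (v, u)" by fastforce
        then have u: "u \<in> ?I" and v: "v \<in> ?I" using p by auto
        from nz have "E x u \<noteq> 0" "?R u v \<noteq> 0" "E v y \<noteq> 0" by (auto simp: T_def vu)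
        then have du: "drop (Suc j) x = drop (Suc j) u" and dv: "drop (Suc j) v = drop (Suc j) y"
          and "\<exists>w. take (Suc j) u = replicate (Suc j) w \<and> take (Suc j) v = replicate (Suc j) w"
          unfolding E_def eqmat_match_edges[OF x u] eqmat_match_edges[OF v y] eqmat_path_edges[OF u v j]
          by (metis (full_types))+
        then obtain w where w: "take (Suc j) u = replicate (Suc j) w" "take (Suc j) v = replicate (Suc j) w" by blast
        have "u = c w" unfolding c_def du w(1)[symmetric] by simp
        moreover have "v = d w" unfolding d_def dv[symmetric] w(2)[symmetric] by simp
        moreover have "w \<in> gverts G"
        proof -
          have "w \<in> set (take (Suc j) u)" unfolding w by simp
          then show ?thesis using u by (auto simp: idx_def dest: in_set_takeD)
        qed
        ultimately show False using p vu by blast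
      qed
    qed
    also have "\<dots> = (\<Sum>w\<in>gverts G. T (c w) (d w))"
      by (simp add: sum.reindex[OF inj])
    also have "\<dots> = (\<Sum>w\<in>gverts G. \<Sum>z\<in>idx j G. X (z @ [w] @ drop (Suc j) x) (z @ [w] @ drop (Suc j) y))"
    proof (rule sum.cong)
      fix w assume w: "w \<in> gverts G"
      have dc: "drop (Suc j) (c w) = drop (Suc j) x" "drop (Suc j) (d w) = drop (Suc j) y"
        "take (Suc j) (c w) = replicate (Suc j) w" "take (Suc j) (d w) = replicate (Suc j) w"
        by (simp_all add: c_def d_def del: replicate_Suc)
      have "E x (c w) = 1" "E (d w) y = 1"
        unfolding E_def eqmat_match_edges[OF x cd(1)[OF w]] eqmat_match_edges[OF cd(2)[OF w] y] dc by simp_all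
      moreover have "?R (c w) (d w) = 1"
        unfolding eqmat_path_edges[OF cd[OF w] j] dc by (rule if_P) blast
      \<comment> \<open>The stage j partial trace ignores the first j copies of w; the remaining
        copy sits at coordinate j on both sides.\<close>
      moreover have "drop j (c w) = [w] @ drop (Suc j) x" "drop j (d w) = [w] @ drop (Suc j) y"
        unfolding c_def d_def replicate_Suc replicate_append_same[symmetric] by simp_all
      ultimately show "T (c w) (d w) = (\<Sum>z\<in>idx j G. X (z @ [w] @ drop (Suc j) x) (z @ [w] @ drop (Suc j) y))"
        using cd[OF w] by (simp add: T_def ptrace_def)
    qed simp
    also have "\<dots> = ptrace k G (Suc j) X x y"
      using True by (simp add: ptrace_def sum_idx_Suc)
    finally show ?thesis ..
  qed (auto simp: ptrace_def mmult_def)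
qed

lemma supported_hmat: "supported k G (hmat k G F)"
  by (auto simp: supported_def hmat_def)

text \<open>The factors in \<open>ptrace_Suc\<close> come from minors of the permitted kinds: the
  matching pattern enters by series composition only, and the path pattern, which enters by parallel
  composition, is a minor of the cycle.\<close>

lemma PP_ptrace:
  fixes G :: "'a graph" and H :: "'b graph"
  assumes k: "k \<ge> 1" and G: "finite (gverts G)" and H: "finite (gverts H)" and F: "F \<in> PP k" and "j \<le> k"
  shows "\<exists>F'\<in>PP k. hmat k G F' = ptrace k G j (hmat k G F) \<and> hmat k H F' = ptrace k H j (hmat k H F)"
  using assms(5)
proof (induction j)
  case 0
  then show ?case using F by (auto simp: ptrace_0 supported_hmat)
next
  case (Suc j)
  then have j: "j < k" by simp
  from Suc obtain F' where F': "F' \<in> PP k" "hmat k G F' = ptrace k G j (hmat k G F)" "hmat k H F' = ptrace k H j (hmat k H F)"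
    by auto
  obtain D where D: "D \<in> QS k" "hmat k G D = eqmat k G (match_edges k (Suc j))" "hmat k H D = eqmat k H (match_edges k (Suc j))"
    using eqmat_QS[OF k match_edges_subset, of G "Suc j" H] by blast
  obtain R where R: "R \<in> QP k" "hmat k G R = eqmat k G (path_edges k j)" "hmat k H R = eqmat k H (path_edges k j)"
    using eqmat_QP[OF k path_edges_subset[OF j], of G H] by blast
  have D': "D \<in> PP k" using D(1) by (intro PP.base QS_subset_Q)
  have R': "parallel F' R \<in> PP k" by (rule PP.par[OF F'(1) R(1)])
  have S: "series D (parallel F' R) \<in> PP k" by (rule PP.ser[OF D' R'])
  have W: "series (series D (parallel F' R)) D \<in> PP k" by (rule PP.ser[OF S D'])
  note wf = wf_PP[OF k]
  have Rwf: "wf_blg k R" using wf_Q[OF k QP_subset_Q[OF R(1)]] .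
  have "hmat k G (series (series D (parallel F' R)) D) = ptrace k G (Suc j) (hmat k G F)"
    unfolding ptrace_Suc[OF G j] hmat_series[OF wf[OF S] wf[OF D'] G] hmat_series[OF wf[OF D'] wf[OF R'] G]
      hmat_parallel[OF wf[OF F'(1)] Rwf] D R F' ..
  moreover have "hmat k H (series (series D (parallel F' R)) D) = ptrace k H (Suc j) (hmat k H F)"
    unfolding ptrace_Suc[OF H j] hmat_series[OF wf[OF S] wf[OF D'] H] hmat_series[OF wf[OF D'] wf[OF R'] H]
      hmat_parallel[OF wf[OF F'(1)] Rwf] D R F' ..
  ultimately show ?case using W by blast
qed

lemma hom_count_eq_sum:
  fixes G :: "'a graph"
  assumes F: "wf_blg k F" and G: "finite (gverts G)"
  shows "of_nat (hom_count (bgraph F) G) = (\<Sum>x\<in>idx k G. \<Sum>y\<in>idx k G. hmat k G F x y)"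
proof -
  let ?S = "\<lambda>p. {h \<in> homs (bgraph F) G. map h (inl F) = fst p \<and> map h (outl F) = snd p}"
  have "map h (inl F) \<in> idx k G" "map h (outl F) \<in> idx k G" if "h \<in> homs (bgraph F) G" for h
    using wf_blgD[OF F] by (auto intro!: map_hom_in_idx[OF that])
  then have "homs (bgraph F) G = (\<Union>p\<in>idx k G \<times> idx k G. ?S p)" by (auto simp del: map_eq_conv)
  then have "hom_count (bgraph F) G = card (\<Union>p\<in>idx k G \<times> idx k G. ?S p)" by (simp add: hom_count_def)
  also have "\<dots> = (\<Sum>p\<in>idx k G \<times> idx k G. card (?S p))"
    using finite_idx[OF G] finite_homs[OF wf_blgD(1)[OF F] G] by (intro card_UN_disjoint) auto
  finally show ?thesis by (simp add: hmat_def sum.cartesian_product case_prod_unfold)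
qed

lemma mtrace_mmult_onesm:
  "mtrace k G (mmult k G X (onesm k G)) = (\<Sum>x\<in>idx k G. \<Sum>y\<in>idx k G. X x y)"
  by (simp add: mtrace_def mmult_def onesm_def)

lemma card_idx: "finite (gverts G) \<Longrightarrow> card (idx k G) = card (gverts G) ^ k"
  unfolding idx_def using card_lists_length_eq[of "gverts G" k] by (simp add: conj_commute)

text \<open>All entries of the matrix of F' equal the wanted trace, so the homomorphism count of F'
  is that trace times the number of entries, which is the same for G and H and can be cancelled when
  it is not 0.\<close>

lemma hom_indist_mtrace:
  fixes G :: "'a graph" and H :: "'b graph"
  assumes k: "k \<ge> 1" and G: "finite (gverts G)" and H: "finite (gverts H)"
    and n: "card (gverts G) = card (gverts H)" and hi: "hom_indist_PP k G H" and F: "F \<in> PP k"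
  shows "mtrace k G (hmat k G F) = mtrace k H (hmat k H F)"
proof (cases "card (idx k G) = 0")
  \<comment> \<open>With empty index sets both traces are empty sums.\<close>
  case True
  then have "idx k G = {}" "idx k H = {}" using finite_idx[OF G] finite_idx[OF H] card_idx[OF G] card_idx[OF H] n
    by (metis card_0_eq)+
  then show ?thesis by (simp add: mtrace_def)
next
  case False
  obtain F' where F': "F' \<in> PP k" "hmat k G F' = ptrace k G k (hmat k G F)" "hmat k H F' = ptrace k H k (hmat k H F)"
    using PP_ptrace[OF k G H F order_refl] by blast
  have "(of_nat (hom_count (bgraph F') G) :: complex) = of_nat (hom_count (bgraph F') H)"
    using hi F'(1) by (simp add: hom_indist_PP_def)
  then have "of_nat (card (idx k G)) * (of_nat (card (idx k G)) * mtrace k G (hmat k G F)) =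
     of_nat (card (idx k H)) * (of_nat (card (idx k H)) * mtrace k H (hmat k H F))"
    unfolding hom_count_eq_sum[OF wf_PP[OF k F'(1)] G] hom_count_eq_sum[OF wf_PP[OF k F'(1)] H] F'
    by (simp add: ptrace_full cong: sum.cong)
  then show ?thesis using False card_idx[OF G, of k] card_idx[OF H, of k] n by auto
qed

subsection \<open>The joint algebra\<close>

inductive_set joint_alg :: "nat \<Rightarrow> 'a graph \<Rightarrow> 'b graph \<Rightarrow> ('a mat \<times> 'b mat) set"
  for k :: nat and G :: "'a graph" and H :: "'b graph" where
  idm: "(idm k G, idm k H) \<in> joint_alg k G H"
| ones: "(onesm k G, onesm k H) \<in> joint_alg k G H"
| hom: "F \<in> Q k \<Longrightarrow> (hmat k G F, hmat k H F) \<in> joint_alg k G H"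
| add: "(X, Y) \<in> joint_alg k G H \<Longrightarrow> (X', Y') \<in> joint_alg k G H \<Longrightarrow> (madd X X', madd Y Y') \<in> joint_alg k G H"
| scale: "(X, Y) \<in> joint_alg k G H \<Longrightarrow> (mscale c X, mscale c Y) \<in> joint_alg k G H"
| mult: "(X, Y) \<in> joint_alg k G H \<Longrightarrow> (X', Y') \<in> joint_alg k G H \<Longrightarrow>
    (mmult k G X X', mmult k H Y Y') \<in> joint_alg k G H"
| ctrans: "(X, Y) \<in> joint_alg k G H \<Longrightarrow> (ctrans X, ctrans Y) \<in> joint_alg k G H"
| had: "F \<in> QP k \<Longrightarrow> (X, Y) \<in> joint_alg k G H \<Longrightarrow>
    (hadamard (hmat k G F) X, hadamard (hmat k H F) Y) \<in> joint_alg k G H"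
| perm: "\<sigma> \<in> cyc_group k \<Longrightarrow> (X, Y) \<in> joint_alg k G H \<Longrightarrow>
    (mperm k G \<sigma> X, mperm k H \<sigma> Y) \<in> joint_alg k G H"

text \<open>Generated by sums and multiples instead of written as finite linear combinations, so
  that arguments by linearity become inductions.\<close>

inductive_set hom_span :: "nat \<Rightarrow> 'a graph \<Rightarrow> 'b graph \<Rightarrow> ('a mat \<times> 'b mat) set"
  for k :: nat and G :: "'a graph" and H :: "'b graph" where
  hom: "F \<in> PP k \<Longrightarrow> (hmat k G F, hmat k H F) \<in> hom_span k G H"
| add: "(X, Y) \<in> hom_span k G H \<Longrightarrow> (X', Y') \<in> hom_span k G H \<Longrightarrow> (madd X X', madd Y Y') \<in> hom_span k G H"
| scale: "(X, Y) \<in> hom_span k G H \<Longrightarrow> (mscale c X, mscale c Y) \<in> hom_span k G H"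

section \<open>Linearity of the operations, and the joint algebra inside the span\<close>

lemma mmult_linear:
  "mmult k G (madd X X') Y = madd (mmult k G X Y) (mmult k G X' Y)"
  "mmult k G Y (madd X X') = madd (mmult k G Y X) (mmult k G Y X')"
  "mmult k G (mscale c X) Y = mscale c (mmult k G X Y)"
  "mmult k G Y (mscale c X) = mscale c (mmult k G Y X)"
  by (auto simp: fun_eq_iff mmult_def madd_def mscale_def algebra_simps sum.distrib sum_distrib_left)

lemma ctrans_linear:
  "ctrans (madd X Y) = madd (ctrans X) (ctrans Y)" "ctrans (mscale c X) = mscale (cnj c) (ctrans X)"
  by (auto simp: fun_eq_iff ctrans_def madd_def mscale_def)

lemma hadamard_linear:
  "hadamard Z (madd X Y) = madd (hadamard Z X) (hadamard Z Y)" "hadamard Z (mscale c X) = mscale c (hadamard Z X)"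
  by (auto simp: fun_eq_iff hadamard_def madd_def mscale_def algebra_simps)

lemma mperm_linear:
  "mperm k G \<sigma> (madd X Y) = madd (mperm k G \<sigma> X) (mperm k G \<sigma> Y)"
  "mperm k G \<sigma> (mscale c X) = mscale c (mperm k G \<sigma> X)"
  by (auto simp: fun_eq_iff mperm_def madd_def mscale_def Let_def)

lemma mtrace_linear:
  "mtrace k G (madd X Y) = mtrace k G X + mtrace k G Y" "mtrace k G (mscale c X) = c * mtrace k G X"
  by (simp_all add: mtrace_def madd_def mscale_def sum.distrib sum_distrib_left)

lemma hadamard_commute: "hadamard X Y = hadamard Y X"
  by (auto simp: fun_eq_iff hadamard_def mult.commute)

text \<open>By bilinearity, two nested inductions reduce this to products of generators, which are
  series compositions.\<close>

lemma hom_span_mult: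
  fixes G :: "'a graph" and H :: "'b graph"
  assumes k: "k \<ge> 1" and G: "finite (gverts G)" and H: "finite (gverts H)"
    and XY: "(X, Y) \<in> hom_span k G H" and XY': "(X', Y') \<in> hom_span k G H"
  shows "(mmult k G X X', mmult k H Y Y') \<in> hom_span k G H"
  using XY
proof (induction rule: hom_span.induct)
  case (hom F)
  show ?case using XY'
  proof (induction rule: hom_span.induct)
    case (hom F')
    show ?case
      using hom_span.hom[OF PP.ser[OF \<open>F \<in> PP k\<close> hom], of G H] wf_PP[OF k hom] wf_PP[OF k \<open>F \<in> PP k\<close>] G H
      by (simp add: hmat_series)
  qed (simp_all add: mmult_linear hom_span.add hom_span.scale)
qed (simp_all add: mmult_linear hom_span.add hom_span.scale)

text \<open>I arises from the matching by contracting all edges, J by deleting them, and adjoints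
  come from \<open>PP_ctrans\<close>. Sums and multiples pass through every operation by linearity,
  the adjoint conjugating the scalar.\<close>

lemma joint_alg_subset_hom_span:
  fixes G :: "'a graph" and H :: "'b graph"
  assumes k: "k \<ge> 1" and G: "finite (gverts G)" and H: "finite (gverts H)"
    and "(X, Y) \<in> joint_alg k G H"
  shows "(X, Y) \<in> hom_span k G H"
  using assms(4)
proof (induction rule: joint_alg.induct)
  case idm
  obtain F where F: "F \<in> QS k" "hmat k G F = eqmat k G (match_edges k 0)" "hmat k H F = eqmat k H (match_edges k 0)"
    using eqmat_QS[OF k match_edges_subset, of G 0 H] by blast
  have "eqmat k G (match_edges k 0) = idm k G"
  proof (intro ext)
    fix x y show "eqmat k G (match_edges k 0) x y = idm k G x y"
      by (cases "x \<in> idx k G \<and> y \<in> idx k G") (simp_all add: eqmat_match_edges idm_def, auto simp: eqmat_def)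
  qed
  moreover have "eqmat k H (match_edges k 0) = idm k H"
  proof (intro ext)
    fix x y show "eqmat k H (match_edges k 0) x y = idm k H x y"
      by (cases "x \<in> idx k H \<and> y \<in> idx k H") (simp_all add: eqmat_match_edges idm_def, auto simp: eqmat_def)
  qed
  ultimately show ?case
    using hom_span.hom[OF PP.base[OF QS_subset_Q[OF F(1)]], of G H] F by simp
next
  case ones
  obtain F where F: "F \<in> QS k" "hmat k G F = eqmat k G {}" "hmat k H F = eqmat k H {}"
    using eqmat_QS[OF k empty_subsetI, of G H] by blast
  have "eqmat k G {} = onesm k G" "eqmat k H {} = onesm k H"
    by (auto simp: fun_eq_iff eqmat_def onesm_def)
  then show ?case
    using hom_span.hom[OF PP.base[OF QS_subset_Q[OF F(1)]], of G H] F by simp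
next
  case (hom F)
  then show ?case by (intro hom_span.hom PP.base)
next
  case (add X Y X' Y')
  then show ?case by (intro hom_span.add)
next
  case (scale X Y c)
  then show ?case by (intro hom_span.scale)
next
  case (mult X Y X' Y')
  then show ?case by (intro hom_span_mult[OF k G H])
next
  case (ctrans X Y)
  from ctrans.IH show ?case
  proof (induction rule: hom_span.induct)
    case (hom F)
    from PP_ctrans[OF k G H hom] obtain F' where
      "F' \<in> PP k" "hmat k G F' = ctrans (hmat k G F)" "hmat k H F' = ctrans (hmat k H F)" by blast
    then show ?case using hom_span.hom[of F' k G H] by simp
  qed (simp_all add: ctrans_linear hom_span.add hom_span.scale)
next
  case (had R X Y)
  from had.IH show ?case
  proof (induction rule: hom_span.induct)
    case (hom F)
    have "wf_blg k R" using wf_Q[OF k QP_subset_Q[OF had.hyps(1)]] .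
    then show ?case
      using hom_span.hom[OF PP.par[OF hom had.hyps(1)], of G H] wf_PP[OF k hom]
      by (simp add: hmat_parallel hadamard_commute)
  qed (simp_all add: hadamard_linear hom_span.add hom_span.scale)
next
  case (perm \<sigma> X Y)
  from perm.IH show ?case
  proof (induction rule: hom_span.induct)
    case (hom F)
    then show ?case
      using hom_span.hom[OF PP.perm[OF hom perm.hyps(1)], of G H] wf_PP[OF k hom]
        cyc_group_permutes[OF k perm.hyps(1)]
      by (simp add: hmat_bperm)
  qed (simp_all add: mperm_linear hom_span.add hom_span.scale)
qed

lemma hom_span_mtrace:
  assumes "k \<ge> 1" "finite (gverts G)" "finite (gverts H)" "card (gverts G) = card (gverts H)" "hom_indist_PP k G H"
    and "(X, Y) \<in> hom_span k G H"
  shows "mtrace k G X = mtrace k H Y"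
  using assms(6)
  by (induction rule: hom_span.induct) (simp_all add: mtrace_linear hom_indist_mtrace[OF assms(1-5)])

section \<open>Definiteness of the trace form and uniqueness of partners\<close>

lemma QAlg_supported: "X \<in> QAlg k G \<Longrightarrow> supported k G X"
  by (induction rule: QAlg.induct)
    (auto simp: supported_def idm_def onesm_def hmat_def madd_def mscale_def mmult_def ctrans_def hadamard_def mperm_def)

text \<open>This trace is the sum of the squared moduli of the entries of X; entries off the index
  set vanish by \<open>supported\<close>.\<close>

lemma mtrace_gram_eq_0:
  assumes "finite (gverts G)" "supported k G X" "mtrace k G (mmult k G X (ctrans X)) = 0"
  shows "X = (\<lambda>_ _. 0)"
proof (intro ext)
  fix x y
  have fin: "finite (idx k G)" by (rule finite_idx[OF assms(1)])
  have "mtrace k G (mmult k G X (ctrans X)) = of_real (\<Sum>x\<in>idx k G. \<Sum>y\<in>idx k G. (cmod (X x y))\<^sup>2)"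
    by (simp add: mtrace_def mmult_def ctrans_def complex_norm_square del: of_real_power)
  then have "(\<Sum>x\<in>idx k G. \<Sum>y\<in>idx k G. (cmod (X x y))\<^sup>2) = 0"
    using assms(3) by (metis of_real_eq_0_iff)
  then have "\<forall>x\<in>idx k G. \<forall>y\<in>idx k G. X x y = 0"
    by (simp add: sum_nonneg_eq_0_iff fin sum_nonneg)
  then show "X x y = 0" using assms(2) by (auto simp: supported_def)
qed

lemma joint_alg_QAlg: "(X, Y) \<in> joint_alg k G H \<Longrightarrow> X \<in> QAlg k G \<and> Y \<in> QAlg k H"
  by (induction rule: joint_alg.induct) (auto intro: QAlg.intros)

text \<open>The rules of \<open>joint_alg\<close> mirror those of \<open>QAlg\<close>, so a
  derivation over G can be replayed over H and yields a partner.\<close>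

lemma QAlg_left: "X \<in> QAlg k G \<Longrightarrow> \<exists>Y. (X, Y) \<in> joint_alg k G H"
  by (induction rule: QAlg.induct) (blast intro: joint_alg.intros)+

lemma QAlg_right: "Y \<in> QAlg k H \<Longrightarrow> \<exists>X. (X, Y) \<in> joint_alg k G H"
  by (induction rule: QAlg.induct) (blast intro: joint_alg.intros)+

lemma madd_mscale_minus_eq_0_iff: "madd X (mscale (-1) Y) = (\<lambda>_ _. 0) \<longleftrightarrow> X = Y"
  by (simp add: fun_eq_iff madd_def mscale_def)

lemma joint_alg_zero_iff:
  assumes "k \<ge> 1" "finite (gverts G)" "finite (gverts H)" "card (gverts G) = card (gverts H)" "hom_indist_PP k G H"
    and XY: "(X, Y) \<in> joint_alg k G H"
  shows "X = (\<lambda>_ _. 0) \<longleftrightarrow> Y = (\<lambda>_ _. 0)"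
proof -
  have "(mmult k G X (ctrans X), mmult k H Y (ctrans Y)) \<in> joint_alg k G H"
    by (intro joint_alg.mult joint_alg.ctrans XY)
  then have tr: "mtrace k G (mmult k G X (ctrans X)) = mtrace k H (mmult k H Y (ctrans Y))"
    using hom_span_mtrace[OF assms(1-5)] joint_alg_subset_hom_span[OF assms(1-3)] by blast
  have supp: "supported k G X" "supported k H Y"
    using joint_alg_QAlg[OF XY] QAlg_supported by blast+
  show ?thesis
  proof
    assume "X = (\<lambda>_ _. 0)"
    then have "mtrace k G (mmult k G X (ctrans X)) = 0" by (simp add: mtrace_def mmult_def)
    then show "Y = (\<lambda>_ _. 0)" unfolding tr by (rule mtrace_gram_eq_0[OF assms(3) supp(2)])
  next
    assume "Y = (\<lambda>_ _. 0)"
    then have "mtrace k H (mmult k H Y (ctrans Y)) = 0" by (simp add: mtrace_def mmult_def)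
    then show "X = (\<lambda>_ _. 0)" unfolding tr[symmetric] by (rule mtrace_gram_eq_0[OF assms(2) supp(1)])
  qed
qed

text \<open>The difference of the two pairs lies in the relation again, and
  \<open>joint_alg_zero_iff\<close> applies to it.\<close>

lemma joint_alg_eq_iff:
  assumes "k \<ge> 1" "finite (gverts G)" "finite (gverts H)" "card (gverts G) = card (gverts H)" "hom_indist_PP k G H"
    and "(X, Y) \<in> joint_alg k G H" "(X', Y') \<in> joint_alg k G H"
  shows "X = X' \<longleftrightarrow> Y = Y'"
proof -
  have "(madd X (mscale (-1) X'), madd Y (mscale (-1) Y')) \<in> joint_alg k G H"
    using assms(6,7) by (intro joint_alg.add joint_alg.scale)
  from joint_alg_zero_iff[OF assms(1-5) this] show ?thesis
    by (simp only: madd_mscale_minus_eq_0_iff)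
qed

section \<open>The two implications\<close>

lemma hom_indist_imp_alg_k_equiv:
  fixes G :: "'a graph" and H :: "'b graph"
  assumes *: "k \<ge> 1" "finite (gverts G)" "finite (gverts H)" "card (gverts G) = card (gverts H)" "hom_indist_PP k G H"
  shows "alg_k_equiv k G H"
proof -
  define \<phi> where "\<phi> X = (THE Y. (X, Y) \<in> joint_alg k G H)" for X
  have eq: "\<phi> X = Y" if "(X, Y) \<in> joint_alg k G H" for X Y
    unfolding \<phi>_def using that joint_alg_eq_iff[OF * that] by (intro the_equality) blast+
  have mem: "(X, \<phi> X) \<in> joint_alg k G H" if "X \<in> QAlg k G" for X
    using QAlg_left[OF that, of H] eq by auto
  have "bij_betw \<phi> (QAlg k G) (QAlg k H)"
  proof (rule bij_betwI')
    show "\<phi> X = \<phi> X' \<longleftrightarrow> X = X'" if "X \<in> QAlg k G" "X' \<in> QAlg k G" for X X'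
      using joint_alg_eq_iff[OF * mem[OF that(1)] mem[OF that(2)]] by blast
    show "\<phi> X \<in> QAlg k H" if "X \<in> QAlg k G" for X
      using joint_alg_QAlg[OF mem[OF that]] by blast
    show "\<exists>X\<in>QAlg k G. Y = \<phi> X" if "Y \<in> QAlg k H" for Y
      using QAlg_right[OF that, of G] eq joint_alg_QAlg by metis
  qed
  moreover have "mtrace k H (\<phi> M) = mtrace k G M" if "M \<in> QAlg k G" for M
    using hom_span_mtrace[OF * joint_alg_subset_hom_span[OF *(1-3) mem[OF that]]] by simp
  \<comment> \<open>Each remaining property of \<phi> is uniqueness of partners, \<open>eq\<close>,
    applied to the rule of \<open>joint_alg\<close> for the operation concerned.\<close>
  ultimately show ?thesis
    unfolding alg_k_equiv_def
    by (intro exI[of _ \<phi>] conjI ballI allI eq joint_alg.intros mem)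
qed

lemma alg_k_equiv_imp_hom_indist:
  fixes G :: "'a graph" and H :: "'b graph"
  assumes k: "k \<ge> 1" and G: "finite (gverts G)" and H: "finite (gverts H)" and "alg_k_equiv k G H"
  shows "hom_indist_PP k G H"
proof -
  from assms(4) obtain \<phi> :: "'a mat \<Rightarrow> 'b mat" where
    mult: "\<forall>M\<in>QAlg k G. \<forall>N\<in>QAlg k G. \<phi> (mmult k G M N) = mmult k H (\<phi> M) (\<phi> N)"
    and had: "\<forall>F\<in>QP k. \<forall>M\<in>QAlg k G. \<phi> (hadamard (hmat k G F) M) = hadamard (hmat k H F) (\<phi> M)"
    and ones: "\<phi> (onesm k G) = onesm k H"
    and hom: "\<forall>F\<in>Q k. \<phi> (hmat k G F) = hmat k H F"
    and perm: "\<forall>\<sigma>\<in>cyc_group k. \<forall>M\<in>QAlg k G. \<phi> (mperm k G \<sigma> M) = mperm k H \<sigma> (\<phi> M)"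
    and tr: "\<forall>M\<in>QAlg k G. mtrace k H (\<phi> M) = mtrace k G M"
    unfolding alg_k_equiv_def by (elim exE conjE)
  note wf = wf_PP[OF k]
  \<comment> \<open>Membership in the algebra is carried along because \<phi> is only known to
    respect the operations there.\<close>
  have \<phi>: "hmat k G F \<in> QAlg k G \<and> \<phi> (hmat k G F) = hmat k H F" if "F \<in> PP k" for F
    using that
  proof induction
    case (base F)
    then show ?case using hom by (simp add: QAlg.hom)
  next
    case (ser F F')
    then show ?case using mult wf G H by (simp add: hmat_series QAlg.mult)
  next
    case (par F F')
    have "wf_blg k F'" using wf_Q[OF k QP_subset_Q[OF par.hyps(2)]] .
    \<comment> \<open>\<open>parallel\<close> takes the cycle minor as its second argument, the
      algebra rule as its first; hence the commutation.\<close>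
    then show ?case
      using par had wf by (simp add: hmat_parallel hadamard_commute[of _ "hmat k _ F'"] QAlg.had)
  next
    case (perm F \<sigma>)
    then show ?case
      using \<open>\<forall>\<sigma>\<in>cyc_group k. \<forall>M\<in>QAlg k G. \<phi> (mperm k G \<sigma> M) = mperm k H \<sigma> (\<phi> M)\<close>
        wf cyc_group_permutes[OF k perm.hyps(2)] by (simp add: hmat_bperm QAlg.perm)
  qed
  show ?thesis
    unfolding hom_indist_PP_def
  proof
    fix F assume F: "F \<in> PP k"
    let ?M = "mmult k G (hmat k G F) (onesm k G)"
    have "?M \<in> QAlg k G" using \<phi>[OF F] by (intro QAlg.mult QAlg.ones) blast
    moreover have "\<phi> ?M = mmult k H (hmat k H F) (onesm k H)"
      using mult \<phi>[OF F] ones QAlg.ones by metis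
    ultimately have "mtrace k G ?M = mtrace k H (mmult k H (hmat k H F) (onesm k H))"
      using tr by metis
    then have "(of_nat (hom_count (bgraph F) G) :: complex) = of_nat (hom_count (bgraph F) H)"
      unfolding mtrace_mmult_onesm hom_count_eq_sum[OF wf[OF F] G] hom_count_eq_sum[OF wf[OF F] H] .
    then show "hom_count (bgraph F) G = hom_count (bgraph F) H" by (simp only: of_nat_eq_iff)
  qed
qed

theorem theorem4p4:
  fixes k :: nat and G :: "'a graph" and H :: "'b graph"
  assumes "k \<ge> 1"
    and "simple_graph G" and "simple_graph H"
    and "card (gverts G) = card (gverts H)"
  shows "hom_indist_PP k G H \<longleftrightarrow> alg_k_equiv k G H"
proof -
  have "finite (gverts G)" "finite (gverts H)" using assms(2,3) by (auto simp: simple_graph_def)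
  then show ?thesis
    using hom_indist_imp_alg_k_equiv[of k G H] alg_k_equiv_imp_hom_indist[of k G H] assms(1,4) by blast
qed

end
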